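(* Let $G=(V,E)$ be a finite simple connected graph. Then $G$ is distance-regular if and only if every two isometric subsets $U,U'\subseteq V$ are perturb-cospectral.
   Context: $\partial(u,v)$ denotes the distance between vertices $u,v$ in $G$. Distance-regular has its standard meaning: for all $i,j,k$, the number of vertices at distance $i$ from $u$ and at distance $j$ from $v$ depends only on $i,j$ and $k=\partial(u,v)$. Two graphs or pseudographs (graphs possibly with loops and multiple edges) are cospectral if their adjacency matrices have the same spectrum with multiplicities. Two vertex subsets $U,U'\subseteq V$ are isometric if there is a one-to-one correspondence $U\to U'$, $u\mapsto u'$, such that $\partial(u,v)=\partial(u',v')$ for all $u,v\in U$. Perturbations of a (pseudo)graph $H$ with adjacency matrix $A=(a_{xy})$, at a vertex $u$ or at two distinct vertices $u,v$: - P1: remove $u$ and all incident edges. - P2: add a loop at $u$ (increase the diagonal entry $a_{uu}$ by $1$). - P3: add a new vertex $\bar u$ adjacent only to $u$ (by a single edge). - P4: flip $uv$, i.e. change the edge $uv$ into a non-edge or vice versa ($a_{uv}$ becomes $0$ if it is nonzero, and $1$ if it is $0$). - P5: amalgamate $u$ and $v$ into one new vertex $u+v$: adjacencies among other vertices are unchanged, the entry for $u+v$ and another vertex $x$ is $a_{ux}+a_{vx}$, and the diagonal entry at $u+v$ is $a_{uu}+a_{vv}+a_{uv}$ (so an edge $uv$ becomes a loop). - P6: add a new vertex $\bar u$ adjacent exactly to $u$ and $v$ (by single edges). Vertex subsets $U,U'$ are perturb-cospectral if there is a one-to-one correspondence $U\to U'$ such that, for every subset $S\subseteq U$ with corresponding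 subset $S'\subseteq U'$, the following holds: whenever $\widetilde G$ is obtained from $G$ by applying perturbations P1–P6 (possibly several, in succession) to the vertices of $S$ and to new vertices created by earlier perturbations, and $\widetilde G'$ is obtained from $G$ by applying the same perturbations in the same order to the corresponding vertices of $S'$ (and corresponding new vertices), the graphs $\widetilde G$ and $\widetilde G'$ are cospectral. *)

theory Defs
  imports
    "Jordan_Normal_Form.Char_Poly"
    "Graph_Theory.Digraph_Component"
begin

text \<open>
  A finite simple graph is a \<^locale>\<open>pair_graph\<close>: a finite, loop-free, symmetric
  arc relation without parallel arcs, the edge \<open>uv\<close> being the two arcs \<open>(u,v)\<close> and \<open>(v,u)\<close>.
\<close>

definition gdist :: "'a pair_pre_digraph \<Rightarrow> 'a \<Rightarrow> 'a \<Rightarrow> nat" where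
  "gdist G u v = (LEAST n. \<exists>p. pre_digraph.awalk (with_proj G) u p v \<and> length p = n)"

definition distance_regular :: "'a pair_pre_digraph \<Rightarrow> bool" where
  "distance_regular G \<longleftrightarrow>
     (\<exists>p :: nat \<Rightarrow> nat \<Rightarrow> nat \<Rightarrow> nat. \<forall>i j k. \<forall>u\<in>pverts G. \<forall>v\<in>pverts G. gdist G u v = k \<longrightarrow>
        card {w \<in> pverts G. gdist G u w = i \<and> gdist G v w = j} = p i j k)"

definition isometric :: "'a pair_pre_digraph \<Rightarrow> 'a set \<Rightarrow> 'a set \<Rightarrow> bool" where
  "isometric G U U' \<longleftrightarrow>
     (\<exists>f. bij_betw f U U' \<and> (\<forall>u\<in>U. \<forall>v\<in>U. gdist G u v = gdist G (f u) (f v)))"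


text \<open>
  A pseudograph is given by its vertices and the entries of its adjacency matrix: \<open>mult H x y\<close>
  is the number of edges between \<open>x\<close> and \<open>y\<close>, and \<open>mult H x x\<close> the number of loops at \<open>x\<close>.
  Entries at arguments outside \<open>nodes H\<close> are irrelevant.
\<close>

record 'v pseudograph =
  nodes :: "'v set"
  mult :: "'v \<Rightarrow> 'v \<Rightarrow> nat"

text \<open>
  Since the adjacency matrix has numerical indices, the vertices are enumerated in an arbitrary
  order. Another order yields a matrix conjugated by a permutation, hence the same spectrum.
\<close>

definition adjacency_matrix :: "'v pseudograph \<Rightarrow> complex mat" where
  "adjacency_matrix H =
     (let xs = (SOME xs. distinct xs \<and> set xs = nodes H)
      in mat (length xs) (length xs) (\<lambda>(i, j). of_nat (mult H (xs ! i) (xs ! j))))"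

definition spectrum_mset :: "complex mat \<Rightarrow> complex multiset" where
  "spectrum_mset A = proots (char_poly A)"

definition cospectral :: "'v pseudograph \<Rightarrow> 'w pseudograph \<Rightarrow> bool" where
  "cospectral H H' \<longleftrightarrow>
     spectrum_mset (adjacency_matrix H) = spectrum_mset (adjacency_matrix H')"


text \<open>
  Vertices of perturbed graphs are vertices of the original graph or vertices created by a
  perturbation. Each perturbation that creates a vertex specifies the label \<open>k\<close> of the new
  vertex \<open>New k\<close>; the label must not be in use (see \<open>applicable\<close> below), but is otherwise
  immaterial.
\<close>

datatype 'a vertex = Orig 'a | New nat

datatype 'a perturbation =
    Remove "'a vertex"
  | Add_Loop "'a vertex"
  | Add_Pendant "'a vertex" nat
  | Flip "'a vertex" "'a vertex"
  | Amalgamate "'a vertex" "'a vertex" nat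
  | Add_Common_Neighbour "'a vertex" "'a vertex" nat

definition pseudograph_of :: "'a pair_pre_digraph \<Rightarrow> 'a vertex pseudograph" where
  "pseudograph_of G =
     \<lparr> nodes = Orig ` pverts G,
       mult = (\<lambda>x y. if \<exists>u v. x = Orig u \<and> y = Orig v \<and> (u, v) \<in> parcs G then 1 else 0) \<rparr>"

definition add_node :: "'v \<Rightarrow> 'v set \<Rightarrow> 'v pseudograph \<Rightarrow> 'v pseudograph" where
  "add_node z N H =
     \<lparr> nodes = insert z (nodes H),
       mult = (\<lambda>x y. if x = z \<and> y = z then 0
                     else if x = z then (if y \<in> N then 1 else 0)
                     else if y = z then (if x \<in> N then 1 else 0)
                     else mult H x y) \<rparr>"

fun perturb :: "'a perturbation \<Rightarrow> 'a vertex pseudograph \<Rightarrow> 'a vertex pseudograph" where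
  "perturb (Remove u) H = \<lparr> nodes = nodes H - {u}, mult = mult H \<rparr>"
| "perturb (Add_Loop u) H =
     \<lparr> nodes = nodes H,
       mult = (\<lambda>x y. if x = u \<and> y = u then mult H u u + 1 else mult H x y) \<rparr>"
| "perturb (Add_Pendant u k) H = add_node (New k) {u} H"
| "perturb (Flip u v) H =
     \<lparr> nodes = nodes H,
       mult = (\<lambda>x y. if (x = u \<and> y = v) \<or> (x = v \<and> y = u)
                     then (if mult H x y = 0 then 1 else 0)
                     else mult H x y) \<rparr>"
| "perturb (Amalgamate u v k) H =
     \<lparr> nodes = insert (New k) (nodes H - {u, v}),
       mult = (\<lambda>x y. if x = New k \<and> y = New k then mult H u u + mult H v v + mult H u v
                     else if x = New k then mult H u y + mult H v y
                     else if y = New k then mult H x u + mult H x v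
                     else mult H x y) \<rparr>"
| "perturb (Add_Common_Neighbour u v k) H = add_node (New k) {u, v} H"

definition available :: "'a set \<Rightarrow> 'a vertex pseudograph \<Rightarrow> 'a vertex set" where
  "available S H = nodes H \<inter> (Orig ` S \<union> range New)"

fun applicable :: "'a set \<Rightarrow> 'a vertex pseudograph \<Rightarrow> 'a perturbation \<Rightarrow> bool" where
  "applicable S H (Remove u) \<longleftrightarrow> u \<in> available S H"
| "applicable S H (Add_Loop u) \<longleftrightarrow> u \<in> available S H"
| "applicable S H (Add_Pendant u k) \<longleftrightarrow> u \<in> available S H \<and> New k \<notin> nodes H"
| "applicable S H (Flip u v) \<longleftrightarrow> u \<in> available S H \<and> v \<in> available S H \<and> u \<noteq> v"
| "applicable S H (Amalgamate u v k) \<longleftrightarrow>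
     u \<in> available S H \<and> v \<in> available S H \<and> u \<noteq> v \<and> New k \<notin> nodes H"
| "applicable S H (Add_Common_Neighbour u v k) \<longleftrightarrow>
     u \<in> available S H \<and> v \<in> available S H \<and> u \<noteq> v \<and> New k \<notin> nodes H"

fun perturbs :: "'a perturbation list \<Rightarrow> 'a vertex pseudograph \<Rightarrow> 'a vertex pseudograph" where
  "perturbs [] H = H"
| "perturbs (p # ps) H = perturbs ps (perturb p H)"

fun applicables :: "'a set \<Rightarrow> 'a vertex pseudograph \<Rightarrow> 'a perturbation list \<Rightarrow> bool" where
  "applicables S H [] \<longleftrightarrow> True"
| "applicables S H (p # ps) \<longleftrightarrow> applicable S H p \<and> applicables S (perturb p H) ps"

text \<open>
  \<open>map_perturbation f\<close> replaces each original vertex \<open>Orig u\<close> by \<open>Orig (f u)\<close> and keeps the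
  new vertices, so corresponding new vertices have equal labels. As \<open>f\<close> is injective on \<open>S\<close>,
  the resulting sequence is applicable on \<open>f ` S\<close> whenever the given one is on \<open>S\<close>.
\<close>

definition perturb_cospectral :: "'a pair_pre_digraph \<Rightarrow> 'a set \<Rightarrow> 'a set \<Rightarrow> bool" where
  "perturb_cospectral G U U' \<longleftrightarrow>
     (\<exists>f. bij_betw f U U' \<and>
        (\<forall>S\<subseteq>U. \<forall>ps. applicables S (pseudograph_of G) ps \<longrightarrow>
           cospectral (perturbs ps (pseudograph_of G))
                      (perturbs (map (map_perturbation f) ps) (pseudograph_of G))))"

end

theory Submission
  imports Defs
begin

text \<open>
  Write \<open>K = (x I - A)\<inverse>\<close> for the resolvent of the adjacency matrix \<open>A\<close>.

  If \<open>G\<close> is distance-regular, the entries of \<open>K\<close> depend only on distances: the ansatz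
  \<open>K\<^sub>u\<^sub>v = \<kappa> (\<partial>(u, v))\<close> leads to a linear system with the intersection matrix, which is solvable
  for all but finitely many \<open>x\<close>. Hence the determinant of \<open>x I - A\<close> with the block on
  \<open>S \<times> S\<close> replaced by an arbitrary matrix \<open>X\<close> is the same function of \<open>X\<close> for \<open>S\<close> and for an
  isometric copy of \<open>S\<close>. Each perturbation transforms this function of \<open>X\<close> by a rule that does
  not refer to the rest of the graph, so the agreement persists.

  Conversely, joining a new vertex to all of \<open>U\<close> multiplies the characteristic polynomial by
  \<open>x - (\<Sum>u\<in>U. \<Sum>v\<in>U. K\<^sub>u\<^sub>v)\<close>. Taking \<open>U = {u}\<close> and \<open>U = {u, v}\<close> shows that the entries of
  \<open>K\<close> depend only on distances. Letting \<open>x\<close> tend to infinity in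
  \<open>x A\<^sup>l K = A\<^sup>l + A\<^sup>l\<^sup>+\<^sup>1 K\<close> yields the same for all powers of \<open>A\<close>. Since the distance matrices are
  linear combinations of these powers, so are their products, whose entries are the numbers of
  vertices at distances \<open>i\<close> and \<open>j\<close> from two given vertices.
\<close>

section \<open>Determinants over finite index sets\<close>

text \<open>The Leibniz sum over an unordered index set. Vertices act as indices directly, so adding
  or deleting a vertex only changes \<open>N\<close>, and no enumeration has to be carried
  along.\<close>

definition setdet :: "'i set \<Rightarrow> ('i \<Rightarrow> 'i \<Rightarrow> 'b :: comm_ring_1) \<Rightarrow> 'b" where
  "setdet N M = (\<Sum>p | p permutes N. of_int (sign p) * (\<Prod>i\<in>N. M i (p i)))"

definition idm :: "'i \<Rightarrow> 'i \<Rightarrow> 'b :: comm_ring_1" where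
  "idm i j = (if i = j then 1 else 0)"

lemma idm_simps [simp]: "idm i i = 1" "i \<noteq> j \<Longrightarrow> idm i j = 0"
  by (simp_all add: idm_def)

definition mmul :: "'i set \<Rightarrow> ('i \<Rightarrow> 'i \<Rightarrow> 'b :: comm_ring_1) \<Rightarrow> ('i \<Rightarrow> 'i \<Rightarrow> 'b) \<Rightarrow> 'i \<Rightarrow> 'i \<Rightarrow> 'b" where
  "mmul N A B i j = (\<Sum>k\<in>N. A i k * B k j)"

lemma mmul_cong:
  "\<lbrakk>\<And>k. k \<in> N \<Longrightarrow> A i k = A' i k; \<And>k. k \<in> N \<Longrightarrow> B k j = B' k j\<rbrakk> \<Longrightarrow>
    mmul N A B i j = mmul N A' B' i j"
  unfolding mmul_def by (intro sum.cong) auto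

lemma mmul_assoc: "mmul N (mmul N A B) C i j = mmul N A (mmul N B C) i j"
  unfolding mmul_def sum_distrib_left sum_distrib_right
  by (subst sum.swap) (simp add: mult.assoc)

lemma mmul_idm:
  assumes "finite N" "i \<in> N"
  shows "mmul N idm M i j = M i j"
proof -
  have "mmul N idm M i j = (\<Sum>k\<in>N. if k = i then M i j else 0)"
    unfolding mmul_def by (intro sum.cong) (auto simp: idm_def)
  then show ?thesis using assms by simp
qed

lemma mmul_idm_right:
  assumes "finite N" "j \<in> N"
  shows "mmul N M idm i j = M i j"
proof -
  have "mmul N M idm i j = (\<Sum>k\<in>N. if k = j then M i j else 0)"
    unfolding mmul_def by (intro sum.cong) (auto simp: idm_def)
  then show ?thesis using assms by simp
qed

lemma setdet_cong:
  assumes "N = N'" and "\<And>i j. i \<in> N' \<Longrightarrow> j \<in> N' \<Longrightarrow> M i j = M' i j"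
  shows "setdet N M = setdet N' M'"
  unfolding setdet_def assms(1)
  by (intro sum.cong refl arg_cong2[where f = "(*)"] prod.cong assms(2))
     (auto simp: permutes_in_image)

text \<open>Conjugation by \<open>f\<close> turns the permutations of \<open>N\<close> into those of
  \<open>N'\<close> and preserves signs.\<close>

lemma setdet_reindex:
  assumes f: "bij_betw f N N'" and fin: "finite N"
  shows "setdet N' M = setdet N (\<lambda>i j. M (f i) (f j))"
proof -
  have inj: "inj_on f N" and im: "f ` N = N'" using f by (auto simp: bij_betw_def)
  let ?g = "inv_into N f"
  have g: "bij_betw ?g N' N" using f by (rule bij_betw_inv_into)
  have "setdet N (\<lambda>i j. M (f i) (f j)) = setdet N' M"
    unfolding setdet_def
  proof (rule sum.reindex_bij_witness[where i = "map_permutation N' ?g" and j = "map_permutation N f"])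
    fix p assume "p \<in> {p. p permutes N}"
    then have p: "p permutes N" by simp
    show "map_permutation N' ?g (map_permutation N f p) = p"
      by (rule map_permutation_compose_inv[OF f p]) (simp add: inj)
    show "map_permutation N f p \<in> {p. p permutes N'}"
      using map_permutation_permutes[OF f p] by simp
    have "(\<Prod>i\<in>N'. M i (map_permutation N f p i)) = (\<Prod>i\<in>N. M (f i) (f (p i)))"
      using im inj by (auto simp: prod.reindex map_permutation_apply[OF inj] intro!: prod.cong)
    then show "of_int (sign (map_permutation N f p)) * (\<Prod>i\<in>N'. M i (map_permutation N f p i)) =
        of_int (sign p) * (\<Prod>i\<in>N. M (f i) (f (p i)))"
      using sign_map_permutation[OF inj p fin] by simp
  next
    fix q assume "q \<in> {p. p permutes N'}"
    then have q: "q permutes N'" by simp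
    show "map_permutation N f (map_permutation N' ?g q) = q"
      by (rule map_permutation_compose_inv[OF g q]) (simp add: f_inv_into_f im)
    show "map_permutation N' ?g q \<in> {p. p permutes N}"
      using map_permutation_permutes[OF g q] by simp
  qed
  then show ?thesis by simp
qed

text \<open>The link to \<open>det\<close>, through which multiplicativity, transposition and the
  adjugate are inherited.\<close>

lemma setdet_mat:
  assumes "distinct xs"
  shows "setdet (set xs) M =
    det (mat (length xs) (length xs) (\<lambda>(i, j). M (xs ! i) (xs ! j)))"
proof -
  have b: "bij_betw ((!) xs) {0..<length xs} (set xs)"
    by (rule bij_betw_nth[OF assms]) auto
  show ?thesis
    unfolding setdet_reindex[OF b finite_atLeastLessThan, of M]
    by (auto simp: det_def setdet_def permutes_in_image intro!: sum.cong prod.cong)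
qed

lemma setdet_mult:
  assumes "finite N"
  shows "setdet N (mmul N A B) = setdet N A * setdet N B"
proof -
  obtain xs where xs: "set xs = N" "distinct xs" using finite_distinct_list[OF assms] by blast
  let ?n = "length xs"
  let ?m = "\<lambda>M. mat ?n ?n (\<lambda>(i, j). M (xs ! i) (xs ! j))"
  have b: "bij_betw ((!) xs) {0..<?n} N"
    using bij_betw_nth[OF xs(2)] xs(1) by (metis atLeast0LessThan)
  have m: "setdet N M = det (?m M)" for M using setdet_mat[OF xs(2)] xs(1) by metis
  have "?m (mmul N A B) = ?m A * ?m B"
    by (rule eq_matI)
       (auto simp: mmul_def scalar_prod_def sum.reindex_bij_betw[OF b, symmetric])
  then show ?thesis
    using det_mult[of "?m A" ?n "?m B"] m[of A] m[of B] m[of "mmul N A B"] by simp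
qed

lemma setdet_transpose:
  assumes "finite N"
  shows "setdet N (\<lambda>i j. M j i) = setdet N M"
proof -
  obtain xs where xs: "set xs = N" "distinct xs" using finite_distinct_list[OF assms] by blast
  let ?n = "length xs"
  let ?m = "\<lambda>M. mat ?n ?n (\<lambda>(i, j). M (xs ! i) (xs ! j))"
  have m: "setdet N M = det (?m M)" for M using setdet_mat[OF xs(2)] xs(1) by metis
  have "?m (\<lambda>i j. M j i) = transpose_mat (?m M)" by (rule eq_matI) auto
  then show ?thesis
    using det_transpose[of "?m M" ?n] m[of M] m[of "\<lambda>i j. M j i"] by simp
qed

text \<open>Any permutation that moves \<open>z\<close> picks a zero from row \<open>z\<close>, so
  only the permutations of \<open>N\<close> contribute.\<close>

lemma setdet_row_unit:
  assumes fin: "finite N" and z: "z \<notin> N" and row: "\<And>j. j \<in> N \<Longrightarrow> M z j = 0"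
  shows "setdet (insert z N) M = M z z * setdet N M"
proof -
  have "setdet (insert z N) M =
      (\<Sum>p | p permutes N. of_int (sign p) * (\<Prod>i\<in>insert z N. M i (p i)))"
    unfolding setdet_def
  proof (rule sum.mono_neutral_right)
    show "finite {p. p permutes insert z N}" using fin by (simp add: finite_permutations)
    show "{p. p permutes N} \<subseteq> {p. p permutes insert z N}"
      by (auto intro: permutes_subset)
    show "\<forall>p\<in>{p. p permutes insert z N} - {p. p permutes N}.
       of_int (sign p) * (\<Prod>i\<in>insert z N. M i (p i)) = 0"
    proof
      fix p assume p: "p \<in> {p. p permutes insert z N} - {p. p permutes N}"
      have "p z \<noteq> z"
      proof
        assume "p z = z"
        then have "p permutes N"
          using p by (auto intro!: permutes_superset[where S = "insert z N"])
        then show False using p by simp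
      qed
      moreover have "p z \<in> insert z N" using p by (metis DiffD1 insertI1 mem_Collect_eq permutes_in_image)
      ultimately have "M z (p z) = 0" using row by blast
      then show "of_int (sign p) * (\<Prod>i\<in>insert z N. M i (p i)) = 0"
        using fin z by simp
    qed
  qed
  also have "\<dots> = M z z * setdet N M"
    unfolding setdet_def sum_distrib_left
    using fin z by (auto intro!: sum.cong simp: permutes_not_in)
  finally show ?thesis .
qed

lemma setdet_column_unit:
  assumes "finite N" "z \<notin> N" "\<And>i. i \<in> N \<Longrightarrow> M i z = 0"
  shows "setdet (insert z N) M = M z z * setdet N M"
  using setdet_row_unit[of N z "\<lambda>i j. M j i"] assms
    setdet_transpose[of N M] setdet_transpose[of "insert z N" M] by simp

lemma setdet_idm: "finite N \<Longrightarrow> setdet N idm = (1 :: 'b :: comm_ring_1)"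
proof (induction rule: finite_induct)
  case empty then show ?case by (simp add: setdet_def permutes_empty)
next
  case (insert z N)
  have "setdet (insert z N) idm = (idm z z * setdet N idm :: 'b)"
    using insert by (intro setdet_row_unit idm_simps) auto
  with insert show ?case by simp
qed

section \<open>Row and column operations, Schur complements and inverses\<close>

lemma setdet_row_linear:
  assumes fin: "finite N" and u: "u \<in> N"
    and row: "\<And>j. j \<in> N \<Longrightarrow> M u j = a * A u j + b * B u j"
    and A: "\<And>i j. i \<in> N \<Longrightarrow> i \<noteq> u \<Longrightarrow> j \<in> N \<Longrightarrow> A i j = M i j"
    and B: "\<And>i j. i \<in> N \<Longrightarrow> i \<noteq> u \<Longrightarrow> j \<in> N \<Longrightarrow> B i j = M i j"
  shows "setdet N M = a * setdet N A + b * setdet N B"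
proof -
  have "of_int (sign p) * (\<Prod>i\<in>N. M i (p i)) =
      a * (of_int (sign p) * (\<Prod>i\<in>N. A i (p i))) + b * (of_int (sign p) * (\<Prod>i\<in>N. B i (p i)))"
    if "p permutes N" for p
  proof -
    have pN: "i \<in> N \<Longrightarrow> p i \<in> N" for i using that by (simp add: permutes_in_image)
    have r: "(\<Prod>i\<in>N. C i (p i)) = C u (p u) * (\<Prod>i\<in>N - {u}. C i (p i))" for C :: "'a \<Rightarrow> 'a \<Rightarrow> 'b"
      using fin u by (simp add: prod.remove)
    have "(\<Prod>i\<in>N - {u}. A i (p i)) = (\<Prod>i\<in>N - {u}. M i (p i))"
      "(\<Prod>i\<in>N - {u}. B i (p i)) = (\<Prod>i\<in>N - {u}. M i (p i))"
      using A B pN by (auto intro!: prod.cong)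
    then show ?thesis unfolding r using row[OF pN[OF u]] by (simp add: algebra_simps)
  qed
  then show ?thesis
    unfolding setdet_def sum_distrib_left sum.distrib[symmetric] by (auto intro!: sum.cong)
qed

text \<open>Row \<open>u\<close> of \<open>A\<close> is row \<open>u\<close> of \<open>B\<close>
  plus a multiple of a unit row, and expansion along the unit row leaves the minor without
  \<open>u\<close>.\<close>

lemma setdet_diff_diag:
  assumes fin: "finite N" and u: "u \<in> N"
    and AB: "\<And>i j. i \<in> N \<Longrightarrow> j \<in> N \<Longrightarrow> i \<noteq> u \<or> j \<noteq> u \<Longrightarrow> A i j = B i j"
  shows "setdet N A = setdet N B + (A u u - B u u) * setdet (N - {u}) A"
proof -
  let ?E = "\<lambda>i j. if i = u then idm u j else A i j"
  have "setdet N A = 1 * setdet N B + (A u u - B u u) * setdet N ?E"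
    by (rule setdet_row_linear[OF fin u]) (use AB[OF u] AB in \<open>auto simp: idm_def\<close>)
  moreover have "setdet (insert u (N - {u})) ?E = ?E u u * setdet (N - {u}) ?E"
    by (rule setdet_row_unit) (use fin in auto)
  moreover have "setdet (N - {u}) ?E = setdet (N - {u}) A" by (rule setdet_cong) auto
  ultimately show ?thesis using u by (simp add: insert_absorb)
qed

text \<open>Trades the deletion of an index for a change of one diagonal entry. It is what turns the
  removal and the amalgamation of vertices into operations on a block.\<close>

lemma setdet_remove:
  assumes "finite N" "u \<in> N"
    and "\<And>i j. i \<in> N \<Longrightarrow> j \<in> N \<Longrightarrow> i \<noteq> u \<or> j \<noteq> u \<Longrightarrow> A i j = B i j"
    and "A u u = 1" "B u u = 0"
  shows "setdet (N - {u}) A = setdet N A - setdet N B"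
  using setdet_diff_diag[OF assms(1-3)] assms(4,5) by simp

text \<open>Left multiplication by the elementary matrix \<open>?L\<close>. Its row \<open>v\<close>
  is a unit row and the rest is the identity, so its determinant is 1.\<close>

lemma setdet_add_row:
  assumes fin: "finite N" and uv: "u \<in> N" "v \<in> N" "u \<noteq> v"
  shows "setdet N (\<lambda>i j. if i = u then M u j + c * M v j else M i j) = setdet N M"
proof -
  let ?L = "\<lambda>i j. idm i j + (if i = u \<and> j = v then c else 0)"
  have "mmul N ?L M i j = (if i = u then M u j + c * M v j else M i j)" if "i \<in> N" for i j
  proof -
    have "mmul N ?L M i j =
       (\<Sum>k\<in>N. (if i = k then M i j else 0) + (if i = u then (if k = v then c * M v j else 0) else 0))"
      unfolding mmul_def by (intro sum.cong) (auto simp: idm_def algebra_simps)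
    then show ?thesis using fin uv that by (simp add: sum.distrib)
  qed
  then have "setdet N (\<lambda>i j. if i = u then M u j + c * M v j else M i j) = setdet N (mmul N ?L M)"
    by (intro setdet_cong) auto
  moreover have "setdet N ?L = 1"
  proof -
    have "setdet (insert v (N - {v})) ?L = ?L v v * setdet (N - {v}) ?L"
      by (rule setdet_row_unit) (use fin uv in \<open>auto simp: idm_def\<close>)
    moreover have "setdet (N - {v}) ?L = setdet (N - {v}) idm" by (rule setdet_cong) auto
    ultimately show ?thesis using fin uv by (simp add: setdet_idm insert_absorb idm_def)
  qed
  ultimately show ?thesis using fin by (simp add: setdet_mult)
qed

lemma setdet_add_column:
  assumes "finite N" "u \<in> N" "v \<in> N" "u \<noteq> v"
  shows "setdet N (\<lambda>i j. if j = u then M i u + c * M i v else M i j) = setdet N M"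
  using setdet_add_row[OF assms, of "\<lambda>i j. M j i" c]
    setdet_transpose[OF assms(1), of "\<lambda>i j. if i = u then M j u + c * M j v else M j i"]
    setdet_transpose[OF assms(1), of M]
  by simp

text \<open>Schur complement with respect to a pivot 1, hence free of divisions: right
  multiplication by the unipotent matrix \<open>?L\<close> clears row \<open>z\<close> off the
  diagonal.\<close>

lemma setdet_schur_unit:
  assumes fin: "finite N" and z: "z \<notin> N" and one: "M z z = 1"
  shows "setdet (insert z N) M = setdet N (\<lambda>i j. M i j - M i z * M z j)"
proof -
  let ?I = "insert z N"
  let ?L = "\<lambda>i j. if i = z \<and> j \<noteq> z then - M z j else idm i j"
  let ?P = "mmul ?I M ?L"
  have P: "?P i j = (if j = z then M i z else M i j - M i z * M z j)" if "j \<in> ?I" for i j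
  proof -
    have "?P i j = (\<Sum>k\<in>?I. (if k = j then M i j else 0) + (if k = z then if j = z then 0 else - M i z * M z j else 0))"
      unfolding mmul_def by (intro sum.cong) (auto simp: idm_def)
    then show ?thesis using fin that by (simp add: sum.distrib)
  qed
  have "setdet ?I ?L = ?L z z * setdet N ?L"
    by (rule setdet_column_unit) (use fin z in \<open>auto simp: idm_def\<close>)
  moreover have "setdet N ?L = setdet N idm" by (rule setdet_cong) (use z in auto)
  ultimately have "setdet ?I ?L = 1" using fin by (simp add: setdet_idm idm_def)
  then have "setdet ?I M = setdet ?I ?P" using fin by (simp add: setdet_mult)
  also have "\<dots> = ?P z z * setdet N ?P"
    by (rule setdet_row_unit) (use fin z in \<open>auto simp: P one\<close>)
  also have "setdet N ?P = setdet N (\<lambda>i j. M i j - M i z * M z j)"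
    by (rule setdet_cong) (use z in \<open>auto simp: P\<close>)
  finally show ?thesis by (simp add: P one)
qed

text \<open>Schur complement with respect to the block on \<open>N\<close>: column \<open>z\<close>
  of \<open>?L\<close> is minus \<open>K\<close> times the border column, which clears column
  \<open>z\<close> on \<open>N\<close> and leaves the stated factor in the corner.\<close>

lemma setdet_bordered:
  assumes fin: "finite N" and z: "z \<notin> N"
    and inv: "\<And>i j. i \<in> N \<Longrightarrow> j \<in> N \<Longrightarrow> mmul N M K i j = idm i j"
  shows "setdet (insert z N) M =
    setdet N M * (M z z - (\<Sum>i\<in>N. \<Sum>j\<in>N. M z i * K i j * M j z))"
proof -
  let ?I = "insert z N"
  let ?L = "\<lambda>i j. if j = z \<and> i \<noteq> z then - (\<Sum>k\<in>N. K i k * M k z) else idm i j"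
  let ?P = "mmul ?I M ?L"
  have Pother: "?P i j = M i j" if "j \<in> N" for i j
  proof -
    have "?P i j = (\<Sum>k\<in>?I. if k = j then M i j else 0)"
      unfolding mmul_def using that z by (intro sum.cong) (auto simp: idm_def)
    then show ?thesis using fin that by simp
  qed
  have Pz: "?P i z = M i z - (\<Sum>k\<in>N. mmul N M K i k * M k z)" for i
  proof -
    have "?P i z = M i z + (\<Sum>w\<in>N. M i w * ?L w z)"
      unfolding mmul_def using fin z by (simp add: idm_def)
    also have "(\<Sum>w\<in>N. M i w * ?L w z) = - (\<Sum>w\<in>N. \<Sum>k\<in>N. M i w * K w k * M k z)"
      using z by (auto simp: sum_negf[symmetric] sum_distrib_left mult.assoc intro!: sum.cong)
    also have "\<dots> = - (\<Sum>k\<in>N. mmul N M K i k * M k z)"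
      unfolding mmul_def sum_distrib_right by (subst sum.swap) simp
    finally show ?thesis by simp
  qed
  have "setdet ?I ?L = ?L z z * setdet N ?L"
    by (rule setdet_row_unit) (use fin z in \<open>auto simp: idm_def\<close>)
  moreover have "setdet N ?L = setdet N idm" by (rule setdet_cong) (use z in auto)
  ultimately have "setdet ?I ?L = 1" using fin by (simp add: setdet_idm idm_def)
  then have "setdet ?I M = setdet ?I ?P" using fin by (simp add: setdet_mult)
  also have "\<dots> = ?P z z * setdet N ?P"
  proof (rule setdet_column_unit[OF fin z])
    fix i assume i: "i \<in> N"
    have "(\<Sum>k\<in>N. mmul N M K i k * M k z) = (\<Sum>k\<in>N. if k = i then M i z else 0)"
      by (intro sum.cong) (auto simp: inv i idm_def)
    then show "?P i z = 0" using Pz fin i by simp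
  qed
  also have "setdet N ?P = setdet N M" by (rule setdet_cong) (auto simp: Pother)
  also have "?P z z = M z z - (\<Sum>i\<in>N. \<Sum>j\<in>N. M z i * K i j * M j z)"
    unfolding Pz unfolding mmul_def sum_distrib_right by (subst sum.swap) simp
  finally show ?thesis by simp
qed

text \<open>Expanding along the unit columns one after the other leaves only the minor on the
  intersection of \<open>N\<close> and \<open>S\<close>.\<close>

lemma setdet_columns_unit_cong:
  assumes fin: "finite N"
    and A: "\<And>i j. i \<in> N \<Longrightarrow> j \<in> N - S \<Longrightarrow> A i j = idm i j"
    and B: "\<And>i j. i \<in> N \<Longrightarrow> j \<in> N - S \<Longrightarrow> B i j = idm i j"
    and AB: "\<And>i j. i \<in> N \<inter> S \<Longrightarrow> j \<in> N \<inter> S \<Longrightarrow> A i j = B i j"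
  shows "setdet N A = setdet N B"
proof -
  have *: "setdet N C = setdet (N \<inter> S) C"
    if "\<And>i j. i \<in> N \<Longrightarrow> j \<in> N - S \<Longrightarrow> C i j = idm i j" for C :: "'a \<Rightarrow> 'a \<Rightarrow> 'b"
  proof -
    have "finite D \<Longrightarrow> D \<subseteq> N - S \<Longrightarrow> setdet (N \<inter> S \<union> D) C = setdet (N \<inter> S) C" for D
    proof (induction D rule: finite_induct)
      case (insert z D)
      have "setdet (insert z (N \<inter> S \<union> D)) C = C z z * setdet (N \<inter> S \<union> D) C"
        by (rule setdet_column_unit) (use insert fin that in \<open>auto simp: idm_def\<close>)
      then show ?case using insert that by (simp add: idm_def)
    qed simp
    from this[of "N - S"] fin show ?thesis by (simp add: Int_Diff_Un)
  qed
  show ?thesis using *[of A] *[of B] A B AB setdet_cong[of "N \<inter> S" "N \<inter> S" A B] by simp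
qed

text \<open>By \<open>B + Z = B (I + K Z)\<close>, the determinant sees only the block of \<open>K\<close> on \<open>S\<close>.\<close>

lemma setdet_add_block_cong:
  assumes fin: "finite N"
    and inv: "\<And>i j. i \<in> N \<Longrightarrow> j \<in> N \<Longrightarrow> mmul N B K i j = idm i j"
    and inv': "\<And>i j. i \<in> N \<Longrightarrow> j \<in> N \<Longrightarrow> mmul N B' K' i j = idm i j"
    and det: "setdet N B = setdet N B'"
    and K: "\<And>i j. i \<in> N \<inter> S \<Longrightarrow> j \<in> N \<inter> S \<Longrightarrow> K i j = K' i j"
    and Z: "\<And>i j. i \<notin> S \<or> j \<notin> S \<Longrightarrow> Z i j = 0"
  shows "setdet N (\<lambda>i j. B i j + Z i j) = setdet N (\<lambda>i j. B' i j + Z i j)"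
proof -
  have factor: "setdet N (\<lambda>i j. B i j + Z i j) =
      setdet N B * setdet N (\<lambda>i j. idm i j + mmul N K Z i j)"
    if "\<And>i j. i \<in> N \<Longrightarrow> j \<in> N \<Longrightarrow> mmul N B K i j = idm i j" for B K :: "'a \<Rightarrow> 'a \<Rightarrow> 'b"
  proof -
    have "mmul N B (\<lambda>i j. idm i j + mmul N K Z i j) i j = B i j + Z i j"
      if ij: "i \<in> N" "j \<in> N" for i j
    proof -
      have "mmul N B (\<lambda>i j. idm i j + mmul N K Z i j) i j =
          mmul N B idm i j + mmul N (mmul N B K) Z i j"
        unfolding mmul_assoc by (simp add: mmul_def distrib_left sum.distrib)
      also have "mmul N (mmul N B K) Z i j = mmul N idm Z i j"
        using \<open>\<And>i j. i \<in> N \<Longrightarrow> j \<in> N \<Longrightarrow> mmul N B K i j = idm i j\<close> ij by (intro mmul_cong) auto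
      finally show ?thesis using fin ij by (simp add: mmul_idm mmul_idm_right)
    qed
    then show ?thesis unfolding setdet_mult[OF fin, symmetric] by (intro setdet_cong) auto
  qed
  have "setdet N (\<lambda>i j. idm i j + mmul N K Z i j) = setdet N (\<lambda>i j. idm i j + mmul N K' Z i j)"
  \<comment> \<open>As \<open>Z\<close> is supported on pairs from \<open>S\<close>, the columns of
    \<open>I + K Z\<close> outside \<open>S\<close> are unit columns, and its entries on
    \<open>S\<close> involve \<open>K\<close> only on \<open>S\<close>.\<close>
  proof (rule setdet_columns_unit_cong[OF fin, where S = S])
    fix i j assume ij: "i \<in> N \<inter> S" "j \<in> N \<inter> S"
    have "K i k * Z k j = K' i k * Z k j" if "k \<in> N" for k
      using K[OF ij(1), of k] Z[of k j] that by (cases "k \<in> S") auto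
    then show "idm i j + mmul N K Z i j = idm i j + mmul N K' Z i j"
      by (simp add: mmul_def)
  qed (use Z in \<open>auto simp: mmul_def\<close>)
  then show ?thesis using factor[OF inv] factor[OF inv'] det by simp
qed

text \<open>The inverse is the adjugate divided by the determinant, carried back from list positions
  to \<open>N\<close> by \<open>?h\<close>.\<close>

lemma setdet_nonzero_inverse:
  fixes M :: "'i \<Rightarrow> 'i \<Rightarrow> 'b :: field"
  assumes fin: "finite N" and nz: "setdet N M \<noteq> 0"
  obtains K where "\<And>i j. i \<in> N \<Longrightarrow> j \<in> N \<Longrightarrow> mmul N M K i j = idm i j"
    "\<And>i j. i \<in> N \<Longrightarrow> j \<in> N \<Longrightarrow> mmul N K M i j = idm i j"
proof -
  obtain xs where xs: "set xs = N" "distinct xs" using finite_distinct_list[OF fin] by blast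
  let ?n = "length xs"
  let ?m = "mat ?n ?n (\<lambda>(i, j). M (xs ! i) (xs ! j))"
  have b: "bij_betw ((!) xs) {0..<?n} N"
    using bij_betw_nth[OF xs(2)] xs(1) by (metis atLeast0LessThan)
  let ?h = "inv_into {0..<?n} ((!) xs)"
  let ?K = "\<lambda>i j. adj_mat ?m $$ (?h i, ?h j) / det ?m"
  have m: "?m \<in> carrier_mat ?n ?n" by simp
  note adj = adj_mat[OF m]
  have d: "det ?m \<noteq> 0" using nz setdet_mat[OF xs(2), of M] xs(1) by simp
  have h: "?h (xs ! k) = k" if "k < ?n" for k
    using that b by (simp add: bij_betw_def inv_into_f_f)
  have ex: "\<exists>k<?n. i = xs ! k" if "i \<in> N" for i using that xs(1) by (metis in_set_conv_nth)
  have eq: "(xs ! k = xs ! l) = (k = l)" if "k < ?n" "l < ?n" for k l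
    using that xs(2) by (simp add: nth_eq_iff_index_eq)
  show thesis
  proof (rule that[of ?K])
    fix i j assume "i \<in> N" "j \<in> N"
    then obtain k l where kl: "k < ?n" "l < ?n" "i = xs ! k" "j = xs ! l" using ex by blast
    have "(?m * adj_mat ?m) $$ (k, l) = (\<Sum>w = 0..<?n. M i (xs ! w) * adj_mat ?m $$ (w, l))"
      using kl adj(1) by (auto simp: scalar_prod_def intro!: sum.cong)
    moreover have "(?m * adj_mat ?m) $$ (k, l) = det ?m * idm i j"
      unfolding adj(2) using kl eq by (simp add: idm_def)
    moreover have "mmul N M ?K i j = (\<Sum>w = 0..<?n. M i (xs ! w) * adj_mat ?m $$ (w, l)) / det ?m"
      unfolding mmul_def sum.reindex_bij_betw[OF b, symmetric] sum_divide_distrib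
      using kl h by (auto intro!: sum.cong)
    ultimately show "mmul N M ?K i j = idm i j"
      using d by (simp add: nonzero_divide_eq_eq mult.commute)
    have "(adj_mat ?m * ?m) $$ (k, l) = (\<Sum>w = 0..<?n. adj_mat ?m $$ (k, w) * M (xs ! w) j)"
      using kl adj(1) by (auto simp: scalar_prod_def intro!: sum.cong)
    moreover have "(adj_mat ?m * ?m) $$ (k, l) = det ?m * idm i j"
      unfolding adj(3) using kl eq by (simp add: idm_def)
    moreover have "mmul N ?K M i j = (\<Sum>w = 0..<?n. adj_mat ?m $$ (k, w) * M (xs ! w) j) / det ?m"
      unfolding mmul_def sum.reindex_bij_betw[OF b, symmetric] sum_divide_distrib
      using kl h by (auto intro!: sum.cong)
    ultimately show "mmul N ?K M i j = idm i j"
      using d by (simp add: nonzero_divide_eq_eq mult.commute)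
  qed
qed

lemma poly_char_poly_setdet:
  fixes C :: "'i \<Rightarrow> 'i \<Rightarrow> 'b :: field"
  assumes "distinct xs"
  shows "poly (char_poly (mat (length xs) (length xs) (\<lambda>(i, j). C (xs ! i) (xs ! j)))) x =
    setdet (set xs) (\<lambda>i j. x * idm i j - C i j)"
proof -
  let ?A = "mat (length xs) (length xs) (\<lambda>(i, j). C (xs ! i) (xs ! j))"
  have "- char_matrix ?A x =
     mat (length xs) (length xs) (\<lambda>(i, j). x * idm (xs ! i) (xs ! j) - C (xs ! i) (xs ! j))"
    by (rule eq_matI) (use assms in \<open>auto simp: char_matrix_def idm_def nth_eq_iff_index_eq\<close>)
  then show ?thesis
    unfolding setdet_mat[OF assms] by (subst char_poly_matrix[of _ "length xs"]) auto
qed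

text \<open>These values are the roots of a monic polynomial. Applied to the adjacency matrix and to
  the intersection matrix, this bounds the set of exceptional \<open>x\<close>.\<close>

lemma finite_setdet_char_zero:
  fixes C :: "'i \<Rightarrow> 'i \<Rightarrow> 'b :: field"
  assumes "finite N"
  shows "finite {x. setdet N (\<lambda>i j. x * idm i j - C i j) = 0}"
proof -
  obtain xs where xs: "set xs = N" "distinct xs" using finite_distinct_list[OF assms] by blast
  let ?A = "mat (length xs) (length xs) (\<lambda>(i, j). C (xs ! i) (xs ! j))"
  have "char_poly ?A \<noteq> 0" using degree_monic_char_poly[of ?A "length xs"] by auto
  then have "finite {x. poly (char_poly ?A) x = 0}" by (rule poly_roots_finite)
  then show ?thesis using poly_char_poly_setdet[OF xs(2), of C] xs(1) by simp
qed

section \<open>Characteristic polynomials and distances\<close>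

definition charm :: "complex \<Rightarrow> 'v pseudograph \<Rightarrow> 'v \<Rightarrow> 'v \<Rightarrow> complex" where
  "charm x H i j = x * idm i j - of_nat (mult H i j)"

lemma adjacency_matrix_enumeration:
  assumes "finite (nodes H)"
  obtains xs where "distinct xs" "set xs = nodes H"
    "adjacency_matrix H =
       mat (length xs) (length xs) (\<lambda>(i, j). of_nat (mult H (xs ! i) (xs ! j)))"
proof -
  let ?xs = "SOME xs. distinct xs \<and> set xs = nodes H"
  have "\<exists>xs. distinct xs \<and> set xs = nodes H" using finite_distinct_list[OF assms] by blast
  from someI_ex[OF this] show thesis
    by (intro that[of ?xs]) (auto simp: adjacency_matrix_def Let_def)
qed

lemma poly_char_poly_adjacency:
  assumes "finite (nodes H)"
  shows "poly (char_poly (adjacency_matrix H)) x = setdet (nodes H) (charm x H)"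
proof -
  obtain xs where xs: "distinct xs" "set xs = nodes H"
    "adjacency_matrix H =
       mat (length xs) (length xs) (\<lambda>(i, j). of_nat (mult H (xs ! i) (xs ! j)))"
    using adjacency_matrix_enumeration[OF assms] .
  have "charm x H = (\<lambda>i j. x * idm i j - of_nat (mult H i j))"
    by (intro ext) (simp add: charm_def)
  then show ?thesis
    using poly_char_poly_setdet[OF xs(1), of "\<lambda>i j. of_nat (mult H i j)" x] xs(2,3) by simp
qed

text \<open>Polynomials that agree off a finite set coincide, so the exceptional \<open>x\<close> at
  which a linear system is singular may be left out.\<close>

lemma cospectralI:
  assumes "finite (nodes H)" "finite (nodes H')"
    and "finite F" "\<And>x. x \<notin> F \<Longrightarrow> setdet (nodes H) (charm x H) = setdet (nodes H') (charm x H')"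
  shows "cospectral H H'"
proof -
  let ?p = "char_poly (adjacency_matrix H)" and ?q = "char_poly (adjacency_matrix H')"
  have "{x. poly (?p - ?q) x \<noteq> 0} \<subseteq> F"
    using assms by (auto simp: poly_char_poly_adjacency)
  then have "\<not> finite {x. poly (?p - ?q) x = 0}"
    using assms(3) by (metis (mono_tags) Collect_neg_eq finite_compl infinite_UNIV_char_0 rev_finite_subset)
  then have "?p - ?q = 0" using poly_roots_finite by blast
  then show ?thesis by (simp add: cospectral_def spectrum_mset_def)
qed

text \<open>A monic complex polynomial is the product of its linear factors, so the multiset of
  roots determines the characteristic polynomial and its value at every \<open>x\<close>.\<close>

lemma cospectralD:
  assumes "finite (nodes H)" "finite (nodes H')" "cospectral H H'"
  shows "setdet (nodes H) (charm x H) = setdet (nodes H') (charm x H')"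
proof -
  have lead: "lead_coeff (char_poly (adjacency_matrix K)) = 1"
    if fin: "finite (nodes K)" for K :: "'w pseudograph"
  proof -
    obtain xs where "adjacency_matrix K =
        mat (length xs) (length xs) (\<lambda>(i, j). of_nat (mult K (xs ! i) (xs ! j)))"
      by (rule adjacency_matrix_enumeration[OF fin])
    then show ?thesis using degree_monic_char_poly[of "adjacency_matrix K" "length xs"] by simp
  qed
  have decompose: "char_poly (adjacency_matrix K) =
      (\<Prod>a\<in>#spectrum_mset (adjacency_matrix K). [:- a, 1:])"
    if fin: "finite (nodes K)" for K :: "'w pseudograph"
    using complex_poly_decompose_multiset[of "char_poly (adjacency_matrix K)", symmetric]
    unfolding spectrum_mset_def lead[OF fin] smult_1_left .
  have "char_poly (adjacency_matrix H) = char_poly (adjacency_matrix H')"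
    unfolding decompose[OF assms(1)] decompose[OF assms(2)]
    using assms(3) by (simp only: cospectral_def)
  then show ?thesis
    using poly_char_poly_adjacency[OF assms(1), of x] poly_char_poly_adjacency[OF assms(2), of x]
    by simp
qed

section \<open>Walks and distances in a connected graph\<close>

locale connected_pair_graph = pair_graph G for G :: "'a pair_pre_digraph" +
  assumes conn: "connected (with_proj G)"
begin

abbreviation "V \<equiv> pverts G"
abbreviation "d \<equiv> gdist G"

text \<open>Replaces walks by powers of the arc relation, so that the distance becomes the least
  exponent and facts about it follow from facts about \<open>relpow\<close>.\<close>

lemma awalk_relpow:
  assumes "u \<in> V"
  shows "(\<exists>p. awalk u p v \<and> length p = n) \<longleftrightarrow> (u, v) \<in> parcs G ^^ n"
  using assms
proof (induction n arbitrary: u)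
  case 0 then show ?case by (auto simp: awalk_Nil_iff)
next
  case (Suc n)
  have "(\<exists>p. awalk u p v \<and> length p = Suc n) \<longleftrightarrow>
      (\<exists>w. (u, w) \<in> parcs G \<and> (\<exists>p. awalk w p v \<and> length p = n))"
  proof (intro iffI; elim exE conjE)
    fix p assume "awalk u p v" "length p = Suc n"
    then obtain e es where "e \<in> parcs G" "u = fst e" "awalk (snd e) es v" "length es = n"
      by (cases p) (auto simp: awalk_Cons_iff)
    then show "\<exists>w. (u, w) \<in> parcs G \<and> (\<exists>p. awalk w p v \<and> length p = n)"
      by (intro exI[of _ "snd e"] conjI exI[of _ es]) simp_all
  next
    fix w p assume "(u, w) \<in> parcs G" "awalk w p v" "length p = n"
    then show "\<exists>p. awalk u p v \<and> length p = Suc n"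
      by (intro exI[of _ "(u, w) # p"]) (simp add: awalk_Cons_iff)
  qed
  also have "\<dots> \<longleftrightarrow> (\<exists>w. (u, w) \<in> parcs G \<and> (w, v) \<in> parcs G ^^ n)"
  proof (intro arg_cong[where f = Ex] ext conj_cong refl)
    fix w assume "(u, w) \<in> parcs G"
    then show "(\<exists>p. awalk w p v \<and> length p = n) \<longleftrightarrow> (w, v) \<in> parcs G ^^ n"
      using Suc.IH[of w] arc_snd_in_verts[of "(u, w)"] by simp
  qed
  also have "\<dots> \<longleftrightarrow> (u, v) \<in> parcs G ^^ Suc n"
    using relpow_Suc_I2 relpow_Suc_D2 by metis
  finally show ?case .
qed

lemma arc_sym: "(u, v) \<in> parcs G \<Longrightarrow> (v, u) \<in> parcs G"
  using pair_sym_arcs by (auto simp: symmetric_def sym_def)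

lemma gdist_Least: "u \<in> V \<Longrightarrow> d u v = (LEAST n. (u, v) \<in> parcs G ^^ n)"
  by (simp add: gdist_def awalk_relpow)

text \<open>Connectedness provides some walk from \<open>u\<close> to \<open>v\<close>, so the
  minimum that defines the distance is attained.\<close>

lemma relpow_gdist:
  assumes "u \<in> V" "v \<in> V"
  shows "(u, v) \<in> parcs G ^^ d u v"
proof -
  have "strongly_connected (with_proj G)"
    using symmetric_connected_imp_strongly_connected pair_sym_arcs conn by simp
  then have "\<exists>p. awalk u p v"
    using assms by (auto simp: strongly_connected_def reachable_awalk)
  then have "\<exists>n. (u, v) \<in> parcs G ^^ n" using awalk_relpow assms(1) by blast
  then show ?thesis unfolding gdist_Least[OF assms(1)] by (rule LeastI_ex)
qed

lemma gdist_le: "u \<in> V \<Longrightarrow> (u, v) \<in> parcs G ^^ n \<Longrightarrow> d u v \<le> n"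
  by (simp add: gdist_Least Least_le)

lemma gdist_eq_0_iff: "u \<in> V \<Longrightarrow> v \<in> V \<Longrightarrow> d u v = 0 \<longleftrightarrow> u = v"
  using relpow_gdist[of u v] gdist_le[of u v 0] by auto

lemma relpow_sym: "(u, v) \<in> parcs G ^^ n \<Longrightarrow> (v, u) \<in> parcs G ^^ n"
proof (induction n arbitrary: v)
  case (Suc n)
  from Suc.prems obtain w where "(u, w) \<in> parcs G ^^ n" "(w, v) \<in> parcs G"
    by (rule relpow_Suc_E)
  with Suc.IH show ?case using arc_sym relpow_Suc_I2 by metis
qed simp

lemma gdist_sym:
  assumes "u \<in> V" "v \<in> V"
  shows "d u v = d v u"
  using relpow_gdist relpow_sym gdist_le assms by (meson le_antisym)

lemma gdist_step:
  assumes "(u, w) \<in> parcs G" "v \<in> V"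
  shows "d u v \<le> Suc (d w v)"
  using gdist_le[of u v] relpow_Suc_I2[OF assms(1) relpow_gdist[of w v]]
    arc_fst_in_verts[OF assms(1)] arc_snd_in_verts[OF assms(1)] assms(2) by simp

lemma gdist_SucE:
  assumes "u \<in> V" "v \<in> V" "d u v = Suc n"
  obtains w where "(u, w) \<in> parcs G" "d w v = n"
proof -
  obtain w where w: "(u, w) \<in> parcs G" "(w, v) \<in> parcs G ^^ n"
    using relpow_gdist[OF assms(1,2)] assms(3) relpow_Suc_D2 by metis
  have "w \<in> V" using arc_snd_in_verts[OF w(1)] by simp
  then have "d w v \<le> n" using gdist_le w(2) by blast
  then show thesis using gdist_step[OF w(1) assms(2)] assms(3) that w(1) by simp
qed

lemma gdist_eq_1_iff:
  assumes "u \<in> V" "v \<in> V"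
  shows "d u v = 1 \<longleftrightarrow> (u, v) \<in> parcs G"
proof
  assume "d u v = 1"
  then show "(u, v) \<in> parcs G" using relpow_gdist[OF assms] by simp
next
  assume e: "(u, v) \<in> parcs G"
  then have "d u v \<le> 1" using gdist_le[OF assms(1), of v 1] by simp
  moreover have "d u v \<noteq> 0" using e gdist_eq_0_iff assms no_loops' by blast
  ultimately show "d u v = 1" by simp
qed

definition adj :: "'a \<Rightarrow> 'a \<Rightarrow> complex" where
  "adj u v = (if (u, v) \<in> parcs G then 1 else 0)"

lemma adj_sym: "adj u v = adj v u"
  using arc_sym by (auto simp: adj_def)

lemma adj_gdist: "u \<in> V \<Longrightarrow> v \<in> V \<Longrightarrow> adj u v = (if d u v = 1 then 1 else 0)"
  by (simp only: adj_def gdist_eq_1_iff)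

end

section \<open>From perturbations to distance-regularity\<close>

context connected_pair_graph begin

section \<open>The resolvent of the adjacency matrix\<close>

abbreviation (input) "charadj \<equiv> \<lambda>x u v. x * idm u v - adj u v"

lemma gdist_self [simp]: "u \<in> V \<Longrightarrow> d u u = 0"
  by (simp add: gdist_eq_0_iff)

lemma finite_V [simp]: "finite V"
  using pair_finite_verts .

lemma nodes_pseudograph_of [simp]: "nodes (pseudograph_of G) = Orig ` V"
  by (simp add: pseudograph_of_def)

lemma charm_pseudograph_of [simp]:
  "charm x (pseudograph_of G) (Orig u) (Orig v) = charadj x u v"
  by (simp add: charm_def pseudograph_of_def adj_def idm_def)

lemma setdet_Orig: "setdet (Orig ` W) M = setdet W (\<lambda>u v. M (Orig u) (Orig v))" if "finite W"
  by (rule setdet_reindex) (use that in \<open>auto simp: bij_betw_def inj_on_def\<close>)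

text \<open>A predicate rather than a function: the inverse of \<open>x I - A\<close> exists only
  for \<open>x\<close> outside the spectrum, and \<open>K\<close> is determined only on
  \<open>V\<close>.\<close>

definition resolvent :: "complex \<Rightarrow> ('a \<Rightarrow> 'a \<Rightarrow> complex) \<Rightarrow> bool" where
  "resolvent x K \<longleftrightarrow> (\<forall>u\<in>V. \<forall>v\<in>V. mmul V (charadj x) K u v = idm u v \<and>
      mmul V K (charadj x) u v = idm u v)"

lemma ex_resolvent:
  assumes "setdet V (charadj x) \<noteq> 0"
  obtains K where "resolvent x K"
  by (rule setdet_nonzero_inverse[OF finite_V assms])
     (auto simp: resolvent_def intro!: that)

lemma resolvent_det:
  assumes "resolvent x K" shows "setdet V (charadj x) \<noteq> 0"
proof -
  have "setdet V (charadj x) * setdet V K = setdet V (mmul V (charadj x) K)"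
    by (simp add: setdet_mult)
  also have "\<dots> = setdet V idm"
    by (rule setdet_cong) (use assms in \<open>auto simp: resolvent_def\<close>)
  finally show ?thesis by (auto simp: setdet_idm)
qed

lemma ex_large_resolvent:
  obtains x K where "resolvent x K" "norm x > R"
proof -
  let ?F = "{x. setdet V (charadj x) = 0}"
  have F: "finite ?F" by (rule finite_setdet_char_zero) simp
  \<comment> \<open>Larger in norm than \<open>R\<close> and than every eigenvalue, since each
    eigenvalue is dominated by the sum of all the norms.\<close>
  let ?x = "of_real (1 + \<bar>R\<bar> + (\<Sum>y\<in>?F. norm y)) :: complex"
  have s: "(\<Sum>y\<in>?F. norm y) \<ge> 0" by (simp add: sum_nonneg)
  have n: "norm ?x = 1 + \<bar>R\<bar> + (\<Sum>y\<in>?F. norm y)"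
    unfolding norm_of_real using s by linarith
  have "?x \<notin> ?F"
  proof
    assume "?x \<in> ?F"
    then have "norm ?x \<le> (\<Sum>y\<in>?F. norm y)" using F by (intro member_le_sum) auto
    then show False using n by linarith
  qed
  then obtain K where "resolvent ?x K" using ex_resolvent by blast
  moreover have "norm ?x > R" using n s by linarith
  ultimately show thesis by (rule that)
qed

lemma resolvent_sym:
  assumes K: "resolvent x K" and uv: "u \<in> V" "v \<in> V"
  shows "K u v = K v u"
proof -
  \<comment> \<open>Since \<open>A\<close> is symmetric, the transpose of \<open>K\<close> is also a
    right inverse of \<open>x I - A\<close>. The chain below evaluates \<open>K (x I - A)\<close>
    times the transpose of \<open>K\<close> in two ways.\<close>
  have t: "mmul V (charadj x) (\<lambda>w v. K v w) a v = idm a v" if "a \<in> V" for a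
  proof -
    have "mmul V (charadj x) (\<lambda>w v. K v w) a v = mmul V K (charadj x) v a"
      by (auto simp: mmul_def mult.commute adj_sym idm_def intro!: sum.cong)
    then show ?thesis using K that uv by (auto simp: resolvent_def idm_def)
  qed
  have "K u v = (\<Sum>a\<in>V. K u a * idm a v)"
    using uv by (simp add: idm_def if_distrib cong: if_cong)
  also have "\<dots> = (\<Sum>a\<in>V. \<Sum>w\<in>V. K u a * (charadj x a w * K v w))"
    by (intro sum.cong refl) (simp add: t[symmetric] mmul_def sum_distrib_left)
  also have "\<dots> = (\<Sum>w\<in>V. mmul V K (charadj x) u w * K v w)"
    by (subst sum.swap) (simp add: mmul_def sum_distrib_right mult.assoc)
  also have "\<dots> = (\<Sum>w\<in>V. idm u w * K v w)"
    using K uv by (intro sum.cong) (auto simp: resolvent_def)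
  also have "\<dots> = (\<Sum>w\<in>V. if w = u then K v w else 0)"
    by (intro sum.cong) (auto simp: idm_def)
  also have "\<dots> = K v u" using uv by simp
  finally show ?thesis .
qed

lemma resolvent_eq:
  assumes "resolvent x K" "u \<in> V" "v \<in> V"
  shows "x * K u v = idm u v + (\<Sum>w\<in>V. adj u w * K w v)"
proof -
  have "mmul V (charadj x) K u v =
      (\<Sum>w\<in>V. if w = u then x * K u v else 0) - (\<Sum>w\<in>V. adj u w * K w v)"
    unfolding mmul_def sum_subtractf[symmetric]
    by (intro sum.cong) (auto simp: idm_def algebra_simps)
  then show ?thesis using assms by (simp add: resolvent_def)
qed

text \<open>Let \<open>m\<close> be the largest norm in column \<open>v\<close>. At the row where it
  is attained, \<open>x K = I + A K\<close> gives
  \<open>norm x * m \<le> 1 + card V * m\<close>.\<close>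

lemma resolvent_bound:
  assumes K: "resolvent x K" and x: "norm x > card V" and uv: "u \<in> V" "v \<in> V"
  shows "norm (K u v) \<le> 1 / (norm x - card V)"
proof -
  define m where "m = Max ((\<lambda>u. norm (K u v)) ` V)"
  have le: "norm (K w v) \<le> m" if "w \<in> V" for w unfolding m_def using that by simp
  have "m \<in> (\<lambda>u. norm (K u v)) ` V" unfolding m_def using uv by (intro Max_in) auto
  then obtain a where a: "a \<in> V" "m = norm (K a v)" by blast
  have "norm x * m = norm (idm a v + (\<Sum>w\<in>V. adj a w * K w v))"
    using resolvent_eq[OF K a(1) uv(2)] a(2) by (metis norm_mult)
  also have "\<dots> \<le> norm (idm a v :: complex) + (\<Sum>w\<in>V. norm (adj a w * K w v))"
    by (rule order_trans[OF norm_triangle_ineq add_left_mono[OF norm_sum]])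
  also have "\<dots> \<le> 1 + (\<Sum>w\<in>V. m)"
  proof (intro add_mono sum_mono)
    fix w assume w: "w \<in> V"
    have "norm (adj a w * K w v) \<le> norm (K w v)"
      by (simp add: adj_def norm_mult)
    then show "norm (adj a w * K w v) \<le> m" using le[OF w] by linarith
  qed (simp add: idm_def)
  finally have "(norm x - card V) * m \<le> 1" by (simp add: algebra_simps)
  then have "m \<le> 1 / (norm x - card V)" using x by (simp add: pos_le_divide_eq mult.commute)
  then show ?thesis using le[OF uv(1)] by linarith
qed

lemma setdet_add_node:
  assumes K: "resolvent x K" and U: "U \<subseteq> V"
  shows "setdet (nodes (add_node (New 0) (Orig ` U) (pseudograph_of G)))
      (charm x (add_node (New 0) (Orig ` U) (pseudograph_of G))) =
    setdet V (charadj x) * (x - (\<Sum>u\<in>U. \<Sum>v\<in>U. K u v))"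
proof -
  let ?z = "New 0 :: 'a vertex"
  let ?M = "charm x (add_node ?z (Orig ` U) (pseudograph_of G))"
  let ?un = "\<lambda>i :: 'a vertex. case i of Orig u \<Rightarrow> u"
  let ?K = "\<lambda>i j. K (?un i) (?un j)"
  have M: "?M (Orig u) (Orig v) = charadj x u v" for u v
    using charm_pseudograph_of by (simp add: charm_def add_node_def)
  have Mz: "?M ?z ?z = x" "?M (Orig u) ?z = - (if u \<in> U then 1 else 0)"
    "?M ?z (Orig u) = - (if u \<in> U then 1 else 0)" for u
    by (auto simp: charm_def add_node_def)
  have "setdet (insert ?z (Orig ` V)) ?M = setdet (Orig ` V) ?M *
      (?M ?z ?z - (\<Sum>i\<in>Orig ` V. \<Sum>j\<in>Orig ` V. ?M ?z i * ?K i j * ?M j ?z))"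
  proof (rule setdet_bordered)
    fix i j :: "'a vertex" assume "i \<in> Orig ` V" "j \<in> Orig ` V"
    then obtain u v where "u \<in> V" "v \<in> V" "i = Orig u" "j = Orig v" by blast
    then show "mmul (Orig ` V) ?M ?K i j = idm i j"
      using K by (simp add: mmul_def sum.reindex inj_on_def M resolvent_def idm_def)
  qed auto
  also have "setdet (Orig ` V) ?M = setdet V (charadj x)"
    by (simp add: setdet_Orig M)
  also have "(\<Sum>i\<in>Orig ` V. \<Sum>j\<in>Orig ` V. ?M ?z i * ?K i j * ?M j ?z) =
      (\<Sum>u\<in>V. \<Sum>v\<in>V. if u \<in> U then if v \<in> U then K u v else 0 else 0)"
    by (auto simp: sum.reindex inj_on_def Mz intro!: sum.cong)
  also have "\<dots> = (\<Sum>u\<in>V. if u \<in> U then \<Sum>v\<in>U. K u v else 0)"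
    using U by (intro sum.cong) (auto simp: sum.inter_restrict[symmetric] Int_absorb1)
  also have "\<dots> = (\<Sum>u\<in>U. \<Sum>v\<in>U. K u v)"
    using U by (auto simp: sum.inter_restrict[symmetric] Int_absorb1)
  finally show ?thesis
    unfolding Mz(1) by (simp only: add_node_def pseudograph.select_convs nodes_pseudograph_of)
qed

section \<open>Matrices whose entries depend only on distances\<close>

definition distinv :: "('a \<Rightarrow> 'a \<Rightarrow> complex) \<Rightarrow> bool" where
  "distinv M \<longleftrightarrow> (\<forall>u\<in>V. \<forall>v\<in>V. \<forall>u'\<in>V. \<forall>v'\<in>V. d u v = d u' v' \<longrightarrow> M u v = M u' v')"

lemma distinvD:
  "distinv M \<Longrightarrow> u \<in> V \<Longrightarrow> v \<in> V \<Longrightarrow> u' \<in> V \<Longrightarrow> v' \<in> V \<Longrightarrow> d u v = d u' v' \<Longrightarrow> M u v = M u' v'"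
  unfolding distinv_def by blast

lemma distinv_fun:
  assumes "distinv M"
  obtains c where "\<And>u v. u \<in> V \<Longrightarrow> v \<in> V \<Longrightarrow> M u v = c (d u v)"
proof -
  define c where "c k = (THE m. \<exists>u\<in>V. \<exists>v\<in>V. d u v = k \<and> m = M u v)" for k
  have "M u v = c (d u v)" if "u \<in> V" "v \<in> V" for u v
    unfolding c_def
  proof (rule the_equality[symmetric])
    show "\<exists>a\<in>V. \<exists>b\<in>V. d a b = d u v \<and> M u v = M a b" using that by blast
  next
    fix m assume "\<exists>a\<in>V. \<exists>b\<in>V. d a b = d u v \<and> m = M a b"
    then obtain a b where ab: "a \<in> V" "b \<in> V" "d a b = d u v" "m = M a b" by blast
    show "m = M u v" unfolding ab(4) using assms ab(1,2) that ab(3) by (rule distinvD)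
  qed
  then show thesis by (rule that)
qed

lemma resolvent_sum_eq:
  assumes cosp: "perturb_cospectral G {u, v} {u', v'}"
    and K: "resolvent x K" and V: "u \<in> V" "v \<in> V" "u' \<in> V" "v' \<in> V"
  shows "(\<Sum>a\<in>{u, v}. \<Sum>b\<in>{u, v}. K a b) = (\<Sum>a\<in>{u', v'}. \<Sum>b\<in>{u', v'}. K a b)"
proof -
  obtain f where f: "bij_betw f {u, v} {u', v'}"
    and cs: "\<And>S ps. S \<subseteq> {u, v} \<Longrightarrow> applicables S (pseudograph_of G) ps \<Longrightarrow>
        cospectral (perturbs ps (pseudograph_of G))
          (perturbs (map (map_perturbation f) ps) (pseudograph_of G))"
    using cosp unfolding perturb_cospectral_def by blast
  \<comment> \<open>The correspondence \<open>f\<close> may pair the vertices in either order. Only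
    its image enters, which is why sums over the whole pair are compared.\<close>
  have im: "{f u, f v} = {u', v'}" using f by (auto simp: bij_betw_def)
  let ?A = "\<lambda>U. add_node (New 0) (Orig ` U) (pseudograph_of G)"
  have "cospectral (?A {u, v}) (?A {f u, f v})"
  proof (cases "u = v")
    \<comment> \<open>A pendant vertex at \<open>u\<close> is the degenerate case of a new vertex
      joined to all of \<open>{u, v}\<close>. The label 0 is free because the original graph has no
      new vertices.\<close>
    case True
    then show ?thesis
      using cs[of "{u}" "[Add_Pendant (Orig u) 0]"] V by (auto simp: available_def)
  next
    case False
    then show ?thesis
      using cs[of "{u, v}" "[Add_Common_Neighbour (Orig u) (Orig v) 0]"] V
      by (auto simp: available_def)
  qed
  then have c: "cospectral (?A {u, v}) (?A {u', v'})" unfolding im .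
  have fin: "finite (nodes (?A U))" for U by (simp add: add_node_def)
  have "{u, v} \<subseteq> V" "{u', v'} \<subseteq> V" using V by auto
  from cospectralD[OF fin fin c, of x]
  have "setdet V (charadj x) * (x - (\<Sum>a\<in>{u, v}. \<Sum>b\<in>{u, v}. K a b)) =
      setdet V (charadj x) * (x - (\<Sum>a\<in>{u', v'}. \<Sum>b\<in>{u', v'}. K a b))"
    unfolding setdet_add_node[OF K \<open>{u, v} \<subseteq> V\<close>] setdet_add_node[OF K \<open>{u', v'} \<subseteq> V\<close>] .
  then show ?thesis using resolvent_det[OF K] by simp
qed

lemma isometric_pairs:
  assumes V: "u \<in> V" "v \<in> V" "u' \<in> V" "v' \<in> V" and "d u v = d u' v'"
  shows "isometric G {u, v} {u', v'}"
proof -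
  have eq: "u = v \<longleftrightarrow> u' = v'" using assms gdist_eq_0_iff by metis
  let ?f = "\<lambda>w. if w = u then u' else v'"
  have "bij_betw ?f {u, v} {u', v'}" using eq by (auto simp: bij_betw_def inj_on_def)
  moreover have "\<forall>a\<in>{u, v}. \<forall>b\<in>{u, v}. d a b = d (?f a) (?f b)"
    using assms eq gdist_sym[OF V(1,2)] gdist_sym[OF V(3,4)] by auto
  ultimately show ?thesis unfolding isometric_def by blast
qed

lemma resolvent_distinv:
  assumes cosp: "\<And>U U'. U \<subseteq> V \<Longrightarrow> U' \<subseteq> V \<Longrightarrow> isometric G U U' \<Longrightarrow> perturb_cospectral G U U'"
    and K: "resolvent x K"
  shows "distinv K"
  unfolding distinv_def
proof (intro ballI impI)
  fix u v u' v' assume V: "u \<in> V" "v \<in> V" "u' \<in> V" "v' \<in> V" and eq: "d u v = d u' v'"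
  have s: "(\<Sum>a\<in>{u, v}. \<Sum>b\<in>{u, v}. K a b) = (\<Sum>a\<in>{u', v'}. \<Sum>b\<in>{u', v'}. K a b)"
    if "u \<in> V" "v \<in> V" "u' \<in> V" "v' \<in> V" "d u v = d u' v'" for u v u' v'
    using that by (intro resolvent_sum_eq[OF cosp K] isometric_pairs) auto
  \<comment> \<open>The degenerate pairs \<open>{a}\<close> and \<open>{b}\<close> show that the
    diagonal of \<open>K\<close> is constant.\<close>
  have diag: "K a a = K b b" if "a \<in> V" "b \<in> V" for a b
    using s[of a a b b] that gdist_eq_0_iff[of a a] gdist_eq_0_iff[of b b] by simp
  show "K u v = K u' v'"
  proof (cases "u = v")
    case True
    then have "u' = v'" using eq V gdist_eq_0_iff by metis
    then show ?thesis using True diag V by blast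
  next
    case False
    then have "u' \<noteq> v'" using eq V gdist_eq_0_iff by metis
    \<comment> \<open>By symmetry the off-diagonal entry occurs twice in the sum over the pair, and
      the constant diagonal then cancels.\<close>
    then have "K u u + K v v + 2 * K u v = K u' u' + K v' v' + 2 * K u' v'"
      using s[OF V eq] False resolvent_sym[OF K V(2,1)] resolvent_sym[OF K V(4,3)]
      by (simp add: algebra_simps)
    then show ?thesis using diag[OF V(1,3)] diag[OF V(2,4)] by simp
  qed
qed

fun walks :: "nat \<Rightarrow> 'a \<Rightarrow> 'a \<Rightarrow> nat" where
  "walks 0 u v = (if u = v then 1 else 0)"
| "walks (Suc l) u v = (\<Sum>w\<in>V. if (u, w) \<in> parcs G then walks l w v else 0)"

text \<open>Entries of \<open>A^l\<close>. The walks are counted in \<open>nat\<close>, where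
  positivity can be argued, and the counts are embedded into the complex numbers only here.\<close>

definition apow :: "nat \<Rightarrow> 'a \<Rightarrow> 'a \<Rightarrow> complex" where
  "apow l u v = of_nat (walks l u v)"

lemma apow_0: "apow 0 = idm"
  by (intro ext) (simp add: apow_def idm_def)

lemma apow_Suc: "apow (Suc l) u v = (\<Sum>w\<in>V. adj u w * apow l w v)"
  by (auto simp: apow_def adj_def intro!: sum.cong)

lemma apow_1: "w \<in> V \<Longrightarrow> apow 1 u w = adj u w"
  by (simp add: apow_Suc apow_0 idm_def if_distrib cong: if_cong)

lemma walks_zero:
  "u \<in> V \<Longrightarrow> v \<in> V \<Longrightarrow> d u v > l \<Longrightarrow> walks l u v = 0"
proof (induction l arbitrary: u)
  case 0 then show ?case by (cases "u = v") (auto simp: gdist_eq_0_iff)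
next
  case (Suc l)
  then show ?case using gdist_step[of u _ v] by (fastforce intro!: sum.neutral)
qed

text \<open>A shortest walk is counted. Together with \<open>walks_zero\<close> this makes the
  powers of \<open>A\<close> triangular with respect to distance: \<open>A^l\<close> vanishes beyond
  distance \<open>l\<close> but not at distance \<open>l\<close>.\<close>

lemma walks_pos:
  "u \<in> V \<Longrightarrow> v \<in> V \<Longrightarrow> d u v = l \<Longrightarrow> walks l u v > 0"
proof (induction l arbitrary: u)
  case 0 then show ?case by (cases "u = v") (auto simp: gdist_eq_0_iff)
next
  case (Suc l)
  from gdist_SucE[OF Suc.prems] obtain w where w: "(u, w) \<in> parcs G" "d w v = l" .
  have wV: "w \<in> V" using arc_snd_in_verts[OF w(1)] by simp
  have "0 < walks l w v" using Suc.IH[OF wV Suc.prems(2) w(2)] .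
  also have "walks l w v = (if (u, w) \<in> parcs G then walks l w v else 0)" using w by simp
  also have "\<dots> \<le> walks (Suc l) u v"
    unfolding walks.simps by (rule member_le_sum[OF wV]) auto
  finally show ?case .
qed

lemma apow_add: "u \<in> V \<Longrightarrow> apow (l + m) u v = mmul V (apow l) (apow m) u v"
proof (induction l arbitrary: u)
  case 0 then show ?case by (simp add: apow_0 mmul_idm)
next
  case (Suc l)
  have "apow (Suc l + m) u v = mmul V adj (apow (l + m)) u v" by (simp add: apow_Suc mmul_def)
  also have "\<dots> = mmul V adj (mmul V (apow l) (apow m)) u v"
    using Suc.IH by (intro mmul_cong) auto
  also have "\<dots> = mmul V (mmul V adj (apow l)) (apow m) u v" by (simp add: mmul_assoc)
  also have "mmul V adj (apow l) = apow (Suc l)" by (intro ext) (simp add: apow_Suc mmul_def)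
  finally show ?case .
qed

text \<open>The identity \<open>x K = I + A K\<close>, multiplied by \<open>A^l\<close> from the
  left.\<close>

lemma apow_resolvent:
  assumes K: "resolvent x K" and uv: "u \<in> V" "v \<in> V"
  shows "x * mmul V (apow l) K u v = apow l u v + mmul V (apow (Suc l)) K u v"
proof -
  have "x * mmul V (apow l) K u v = (\<Sum>w\<in>V. apow l u w * (x * K w v))"
    by (simp add: mmul_def sum_distrib_left mult_ac)
  also have "\<dots> = (\<Sum>w\<in>V. apow l u w * (idm w v + mmul V (apow 1) K w v))"
    by (intro sum.cong refl) (simp add: resolvent_eq[OF K _ uv(2)] mmul_def apow_1 flip: One_nat_def)
  also have "\<dots> = (\<Sum>w\<in>V. if w = v then apow l u w else 0) + mmul V (apow l) (mmul V (apow 1) K) u v"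
    unfolding mmul_def[of V "apow l"] sum.distrib[symmetric]
    by (intro sum.cong) (auto simp: idm_def algebra_simps)
  also have "(\<Sum>w\<in>V. if w = v then apow l u w else 0) = apow l u v" using uv by simp
  also have "mmul V (apow l) (mmul V (apow 1) K) u v = mmul V (mmul V (apow l) (apow 1)) K u v"
    by (simp add: mmul_assoc)
  also have "\<dots> = mmul V (apow (Suc l)) K u v"
    using apow_add[OF uv(1), of l 1] by (intro mmul_cong) auto
  finally show ?thesis .
qed

text \<open>Both claims go through one induction: invariance of \<open>A^l\<close> and
  \<open>A^l K\<close> yields that of \<open>A^(l+1) K\<close> by \<open>apow_resolvent\<close>, and
  a limit argument then extracts \<open>A^(l+1)\<close>.\<close>

lemma apow_distinv:
  assumes res: "\<And>x K. resolvent x K \<Longrightarrow> distinv K"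
  shows "distinv (apow l) \<and> (\<forall>x K. resolvent x K \<longrightarrow> distinv (mmul V (apow l) K))"
proof (induction l)
  case 0
  have "distinv (apow 0)"
    unfolding distinv_def apow_0 idm_def
  proof (intro ballI impI)
    fix u v u' v' assume V: "u \<in> V" "v \<in> V" "u' \<in> V" "v' \<in> V" "d u v = d u' v'"
    have "u = v \<longleftrightarrow> u' = v'" using gdist_eq_0_iff[OF V(1,2)] gdist_eq_0_iff[OF V(3,4)] V(5) by simp
    then show "(if u = v then 1 else 0 :: complex) = (if u' = v' then 1 else 0)" by simp
  qed
  moreover have "distinv (mmul V (apow 0) K)" if "resolvent x K" for x K
    unfolding distinv_def
  proof (intro ballI impI)
    fix u v u' v' assume V: "u \<in> V" "v \<in> V" "u' \<in> V" "v' \<in> V" "d u v = d u' v'"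
    show "mmul V (apow 0) K u v = mmul V (apow 0) K u' v'"
      using distinvD[OF res[OF that] V] V(1,3) by (simp only: apow_0 mmul_idm[OF finite_V])
  qed
  ultimately show ?case by blast
next
  case (Suc l)
  let ?A = "apow (Suc l)"
  have AK: "distinv (mmul V ?A K)" if K: "resolvent x K" for x K
    unfolding distinv_def
  proof (intro ballI impI)
    fix u v u' v' assume V: "u \<in> V" "v \<in> V" "u' \<in> V" "v' \<in> V" "d u v = d u' v'"
    have "distinv (mmul V (apow l) K)" "distinv (apow l)" using Suc K by blast+
    then have "mmul V (apow l) K u v = mmul V (apow l) K u' v'" "apow l u v = apow l u' v'"
      using V distinvD by blast+
    then show "mmul V ?A K u v = mmul V ?A K u' v'"
      using apow_resolvent[OF K V(1,2), of l] apow_resolvent[OF K V(3,4), of l] by simp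
  qed
  have "distinv ?A"
    unfolding distinv_def
  proof (intro ballI impI)
    fix u v u' v' assume V: "u \<in> V" "v \<in> V" "u' \<in> V" "v' \<in> V" "d u v = d u' v'"
    let ?B = "apow (Suc (Suc l))"
    define a where "a = ?A u v - ?A u' v'"
    define C where "C = (\<Sum>w\<in>V. norm (?B u w)) + (\<Sum>w\<in>V. norm (?B u' w))"
    have C: "C \<ge> 0" by (simp add: C_def sum_nonneg)
    have "a = 0"
    proof (rule ccontr)
      assume a0: "a \<noteq> 0"
      \<comment> \<open>Here \<open>a\<close> will be a difference of two entries of the product of
        \<open>?B\<close> and \<open>K\<close>. For \<open>x\<close> this large,
        \<open>resolvent_bound\<close> makes their norms add up to less than
        \<open>norm a\<close>.\<close>
      obtain x K where K: "resolvent x K" and x: "norm x > card V + C / norm a"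
        by (rule ex_large_resolvent)
      have xV: "norm x > card V"
        using x C by (smt (verit) divide_nonneg_nonneg norm_ge_zero)
      have b: "norm (mmul V ?B K s v0) \<le> (\<Sum>w\<in>V. norm (?B s w)) * (1 / (norm x - card V))"
        if "v0 \<in> V" for s v0
        unfolding mmul_def sum_distrib_right
      proof (rule sum_norm_le)
        fix w assume "w \<in> V"
        then show "norm (?B s w * K w v0) \<le> norm (?B s w) * (1 / (norm x - card V))"
          unfolding norm_mult by (intro mult_left_mono resolvent_bound[OF K xV _ that]) auto
      qed
      have "mmul V ?A K u v = mmul V ?A K u' v'"
        using distinvD[OF AK[OF K] V] .
      then have "a = mmul V ?B K u' v' - mmul V ?B K u v"
        using apow_resolvent[OF K V(1,2), of "Suc l"] apow_resolvent[OF K V(3,4), of "Suc l"]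
        unfolding a_def by (simp add: algebra_simps)
      then have "norm a \<le> norm (mmul V ?B K u' v') + norm (mmul V ?B K u v)"
        by (simp add: norm_triangle_ineq4)
      also have "\<dots> \<le> C * (1 / (norm x - card V))"
        unfolding C_def distrib_right using b[OF V(4), of u'] b[OF V(2), of u] by linarith
      finally have "norm a * (norm x - card V) \<le> C" using xV by (simp add: pos_le_divide_eq)
      moreover have "C < norm a * (norm x - card V)"
        using x a0 by (simp add: field_simps)
      ultimately show False by linarith
    qed
    then show "?A u v = ?A u' v'" by (simp add: a_def)
  qed
  with AK show ?case by blast
qed

text \<open>The algebra of polynomials in \<open>A\<close>, generated here as a linear span of
  powers. The rule \<open>agree\<close> identifies matrices that coincide on \<open>V\<close>, since
  values elsewhere are not controlled.\<close>

inductive_set walk_algebra :: "('a \<Rightarrow> 'a \<Rightarrow> complex) set" where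
  apow: "apow l \<in> walk_algebra"
| add: "M \<in> walk_algebra \<Longrightarrow> N \<in> walk_algebra \<Longrightarrow> (\<lambda>u v. M u v + N u v) \<in> walk_algebra"
| scale: "M \<in> walk_algebra \<Longrightarrow> (\<lambda>u v. c * M u v) \<in> walk_algebra"
| agree: "M \<in> walk_algebra \<Longrightarrow> (\<And>u v. u \<in> V \<Longrightarrow> v \<in> V \<Longrightarrow> M u v = N u v) \<Longrightarrow> N \<in> walk_algebra"

lemma walk_algebra_distinv:
  assumes "\<And>l. distinv (apow l)" and "M \<in> walk_algebra"
  shows "distinv M"
  using assms(2)
proof induction
  case (apow l) then show ?case using assms(1) .
next
  case (add M N) then show ?case unfolding distinv_def by metis
next
  case (scale M c) then show ?case unfolding distinv_def by metis
next
  case (agree M N) then show ?case unfolding distinv_def by metis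
qed

text \<open>Bilinearity reduces the product to two powers of \<open>A\<close>, whose product is
  again a power by \<open>apow_add\<close>.\<close>

lemma walk_algebra_mult:
  assumes "M \<in> walk_algebra" "N \<in> walk_algebra"
  shows "mmul V M N \<in> walk_algebra"
  using assms(1)
proof induction
  case (apow l)
  from assms(2) show ?case
  proof induction
    case (apow m)
    show ?case by (rule walk_algebra.agree[OF walk_algebra.apow[of "l + m"]]) (simp add: apow_add)
  next
    case (add M N)
    show ?case
      by (rule walk_algebra.agree[OF walk_algebra.add[OF add.IH]])
         (simp add: mmul_def algebra_simps sum.distrib)
  next
    case (scale M c)
    show ?case
      by (rule walk_algebra.agree[OF walk_algebra.scale[OF scale.IH, of c]])
         (simp add: mmul_def sum_distrib_left mult_ac)
  next
    case (agree M N)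
    show ?case by (rule walk_algebra.agree[OF agree.IH]) (auto intro!: mmul_cong simp: agree.hyps)
  qed
next
  case (add M N)
  show ?case
    by (rule walk_algebra.agree[OF walk_algebra.add[OF add.IH]])
       (simp add: mmul_def algebra_simps sum.distrib)
next
  case (scale M c)
  show ?case
    by (rule walk_algebra.agree[OF walk_algebra.scale[OF scale.IH, of c]])
       (simp add: mmul_def sum_distrib_left mult_ac)
next
  case (agree M N)
  show ?case by (rule walk_algebra.agree[OF agree.IH]) (auto intro!: mmul_cong simp: agree.hyps)
qed

lemma walk_algebra_sum:
  assumes "finite I" "\<And>i. i \<in> I \<Longrightarrow> M i \<in> walk_algebra"
  shows "(\<lambda>u v. \<Sum>i\<in>I. M i u v) \<in> walk_algebra"
  using assms
proof (induction I rule: finite_induct)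
  case empty
  show ?case by (rule walk_algebra.agree[OF walk_algebra.scale[OF walk_algebra.apow, of 0]]) simp
next
  case (insert i I)
  have "(\<lambda>u v. M i u v + (\<Sum>i\<in>I. M i u v)) \<in> walk_algebra"
    using insert by (intro walk_algebra.add) auto
  then show ?case using insert by simp
qed

section \<open>Distance matrices and intersection numbers\<close>

definition dist_matrix :: "nat \<Rightarrow> 'a \<Rightarrow> 'a \<Rightarrow> complex" where
  "dist_matrix i u v = (if d u v = i then 1 else 0)"

text \<open>On \<open>V\<close>, \<open>A^i\<close> is a combination of the distance matrices for
  \<open>k \<le> i\<close>, with coefficients \<open>c k\<close> and \<open>c i\<close> nonzero if
  the distance \<open>i\<close> occurs. This triangular system is solved for the last
  matrix.\<close>

lemma dist_matrix_walk_algebra: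
  assumes inv: "\<And>l. distinv (apow l)"
  shows "dist_matrix i \<in> walk_algebra"
proof (induction i rule: less_induct)
  case (less i)
  show ?case
  proof (cases "\<exists>u\<in>V. \<exists>v\<in>V. d u v = i")
    case False
    show ?thesis
      by (rule walk_algebra.agree[OF walk_algebra.scale[OF walk_algebra.apow, of 0]])
         (use False in \<open>auto simp: dist_matrix_def\<close>)
  next
    case True
    then obtain u0 v0 where uv0: "u0 \<in> V" "v0 \<in> V" "d u0 v0 = i" by blast
    obtain c where c: "\<And>u v. u \<in> V \<Longrightarrow> v \<in> V \<Longrightarrow> apow i u v = c (d u v)"
      using distinv_fun[OF inv[of i]] by blast
    have "apow i u0 v0 \<noteq> 0" using walks_pos[OF uv0] by (simp add: apow_def)
    then have ci: "c i \<noteq> 0" using c[OF uv0(1,2)] uv0(3) by simp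
    have "(\<lambda>u v. \<Sum>k<i. - c k * dist_matrix k u v) \<in> walk_algebra"
      by (intro walk_algebra_sum walk_algebra.scale less) auto
    from walk_algebra.scale[OF walk_algebra.add[OF walk_algebra.apow[of i] this], of "1 / c i"]
    show ?thesis
    proof (rule walk_algebra.agree)
      fix u v assume uv: "u \<in> V" "v \<in> V"
      have "(\<Sum>k<i. - c k * dist_matrix k u v) = (\<Sum>k<i. if k = d u v then - c k else 0)"
        by (intro sum.cong) (auto simp: dist_matrix_def)
      also have "\<dots> = (if d u v < i then - c (d u v) else 0)" by simp
      moreover have "apow i u v = 0" if "d u v > i"
        using walks_zero[OF uv that] by (simp add: apow_def)
      ultimately show "1 / c i * (apow i u v + (\<Sum>k<i. - c k * dist_matrix k u v)) = dist_matrix i u v"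
        using c[OF uv] ci by (cases "d u v" i rule: linorder_cases) (auto simp: dist_matrix_def)
    qed
  qed
qed

lemma distance_regular_if_distinv:
  assumes inv: "\<And>l. distinv (apow l)"
  shows "distance_regular G"
proof -
  let ?n = "\<lambda>i j u v. card {w \<in> V. d u w = i \<and> d v w = j}"
  have *: "?n i j u v = ?n i j u' v'"
    if V: "u \<in> V" "v \<in> V" "u' \<in> V" "v' \<in> V" "d u v = d u' v'" for i j u v u' v'
  proof -
    have n: "of_nat (?n i j u v) = mmul V (dist_matrix i) (dist_matrix j) u v"
      if "u \<in> V" "v \<in> V" for u v
    proof -
      have "mmul V (dist_matrix i) (dist_matrix j) u v =
          (\<Sum>w\<in>V. if d u w = i \<and> d v w = j then 1 else 0)"
        unfolding mmul_def
        by (intro sum.cong) (auto simp: dist_matrix_def gdist_sym[OF that(2)])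
      then show ?thesis by (simp add: sum.inter_filter[symmetric])
    qed
    have "distinv (mmul V (dist_matrix i) (dist_matrix j))"
      by (rule walk_algebra_distinv[OF inv])
         (intro walk_algebra_mult dist_matrix_walk_algebra inv)
    then have "of_nat (?n i j u v) = (of_nat (?n i j u' v') :: complex)"
      unfolding n[OF V(1,2)] n[OF V(3,4)] using V by (rule distinvD)
    then show ?thesis by simp
  qed
  \<comment> \<open>By the preceding fact all pairs at distance \<open>k\<close> give one common
    value. If no pair has distance \<open>k\<close>, the value of \<open>p\<close> is
    immaterial.\<close>
  define p where "p = (\<lambda>i j k. THE m. \<exists>u\<in>V. \<exists>v\<in>V. d u v = k \<and> m = ?n i j u v)"
  have "?n i j u v = p i j k" if "u \<in> V" "v \<in> V" "d u v = k" for i j k u v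
    unfolding p_def
  proof (rule the_equality[symmetric])
    show "\<exists>a\<in>V. \<exists>b\<in>V. d a b = k \<and> ?n i j u v = ?n i j a b"
      by (intro bexI[of _ u] bexI[of _ v] conjI that refl)
  next
    fix m assume "\<exists>a\<in>V. \<exists>b\<in>V. d a b = k \<and> m = ?n i j a b"
    then obtain a b where "a \<in> V" "b \<in> V" "d a b = k" "m = ?n i j a b" by blast
    then show "m = ?n i j u v" using *[of a b u v i j] that by simp
  qed
  then show ?thesis unfolding distance_regular_def by blast
qed

end

section \<open>Effect of perturbations on block determinants\<close>

definition relabel :: "('a \<Rightarrow> 'a) \<Rightarrow> 'a vertex pseudograph \<Rightarrow> 'a vertex pseudograph" where
  "relabel \<pi> H = \<lparr> nodes = map_vertex \<pi> ` nodes H,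
     mult = (\<lambda>x y. mult H (map_vertex (Hilbert_Choice.inv \<pi>) x) (map_vertex (Hilbert_Choice.inv \<pi>) y)) \<rparr>"

lemma map_vertex_inv:
  assumes "bij \<pi>"
  shows "map_vertex (Hilbert_Choice.inv \<pi>) (map_vertex \<pi> x) = x" "map_vertex \<pi> (map_vertex (Hilbert_Choice.inv \<pi>) x) = x"
  using assms by (cases x; simp add: bij_is_inj bij_is_surj surj_f_inv_f)+

lemma map_vertex_eq_iff:
  fixes \<pi> :: "'a \<Rightarrow> 'a"
  assumes "bij \<pi>"
  shows "x = map_vertex \<pi> u \<longleftrightarrow> map_vertex (Hilbert_Choice.inv \<pi>) x = u"
  using map_vertex_inv[OF assms] by auto

lemma New_eq_map_vertex: "map_vertex g x = New k \<longleftrightarrow> x = New k"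
  by (cases x) auto

lemma inj_map_vertex: "bij \<pi> \<Longrightarrow> inj (map_vertex \<pi>)"
  by (intro vertex.inj_map bij_is_inj)

text \<open>Renaming commutes with perturbing. Hence perturbing one graph at two different places
  can be viewed as applying a single sequence to two graphs.\<close>

lemma perturb_relabel:
  assumes "bij \<pi>"
  shows "perturb (map_perturbation \<pi> p) (relabel \<pi> H) = relabel \<pi> (perturb p H)"
proof -
  note [simp] = map_vertex_inv[OF assms] New_eq_map_vertex map_vertex_eq_iff[OF assms]
    image_set_diff[OF inj_map_vertex[OF assms]]
  show ?thesis
    by (cases p) (auto simp: relabel_def add_node_def fun_eq_iff)
qed

lemma perturbs_relabel:
  "bij \<pi> \<Longrightarrow> perturbs (map (map_perturbation \<pi>) ps) (relabel \<pi> H) = relabel \<pi> (perturbs ps H)"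
  by (induction ps arbitrary: H) (simp_all add: perturb_relabel)

lemma setdet_relabel:
  assumes "bij \<pi>" "finite (nodes H)"
  shows "setdet (nodes (relabel \<pi> H)) (charm x (relabel \<pi> H)) = setdet (nodes H) (charm x H)"
proof -
  have "bij_betw (map_vertex \<pi>) (nodes H) (nodes (relabel \<pi> H))"
    using inj_map_vertex[OF assms(1)] by (auto simp: bij_betw_def relabel_def intro: inj_on_subset)
  then show ?thesis
  proof (subst setdet_reindex[OF _ assms(2)], assumption, intro setdet_cong refl)
    fix i j
    show "charm x (relabel \<pi> H) (map_vertex \<pi> i) (map_vertex \<pi> j) = charm x H i j"
      using inj_map_vertex[OF assms(1)]
      by (simp add: charm_def relabel_def map_vertex_inv[OF assms(1)] idm_def inj_eq)
  qed
qed

text \<open>An applicable perturbation mentions original vertices from \<open>S\<close> only. This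
  allows a correspondence to be replaced by any permutation that extends it from
  \<open>S\<close>.\<close>

lemma map_perturbation_applicable:
  assumes "applicable S H p" "\<And>u. u \<in> S \<Longrightarrow> f u = g u"
  shows "map_perturbation f p = map_perturbation g p"
proof -
  have "set_vertex v \<subseteq> S" if "v \<in> available S H" for v
    using that by (auto simp: available_def)
  then have "set_perturbation p \<subseteq> S" using assms(1) by (cases p) auto
  then show ?thesis using assms(2) by (auto intro: perturbation.map_cong)
qed

lemma map_perturbation_applicables:
  assumes "applicables S H ps" "\<And>u. u \<in> S \<Longrightarrow> f u = g u"
  shows "map (map_perturbation f) ps = map (map_perturbation g) ps"
  using assms(1)
proof (induction ps arbitrary: H)
  case (Cons p ps)
  have "map_perturbation f p = map_perturbation g p"
    using map_perturbation_applicable[of S H p f g] Cons.prems assms(2) by simp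
  then show ?case using Cons.IH[of "perturb p H"] Cons.prems by simp
qed simp

section \<open>Determinants with a prescribed block\<close>

definition blockm ::
  "complex \<Rightarrow> 'v set \<Rightarrow> 'v pseudograph \<Rightarrow> ('v \<Rightarrow> 'v \<Rightarrow> complex) \<Rightarrow> 'v \<Rightarrow> 'v \<Rightarrow> complex" where
  "blockm x T H X i j = (if i \<in> T \<and> j \<in> T then X i j else charm x H i j)"

definition blockdet ::
  "complex \<Rightarrow> 'v set \<Rightarrow> 'v pseudograph \<Rightarrow> ('v \<Rightarrow> 'v \<Rightarrow> complex) \<Rightarrow> complex" where
  "blockdet x T H X = setdet (nodes H) (blockm x T H X)"

text \<open>Handles loops and flips, which alter only entries that \<open>X\<close>
  overwrites.\<close>

lemma blockdet_change_block:
  assumes "nodes H' = nodes H" "\<And>i j. i \<notin> T \<or> j \<notin> T \<Longrightarrow> mult H' i j = mult H i j"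
  shows "blockdet x T H' X = blockdet x T H X"
  unfolding blockdet_def
  by (rule setdet_cong[OF assms(1)]) (auto simp: blockm_def charm_def assms(2))

lemma blockdet_remove:
  assumes "finite (nodes H)" "u \<in> T" "T \<subseteq> nodes H"
  shows "blockdet x (T - {u}) \<lparr>nodes = nodes H - {u}, mult = mult H\<rparr> X =
    blockdet x T H (\<lambda>i j. if i = u \<and> j = u then 1 else X i j) -
    blockdet x T H (\<lambda>i j. if i = u \<and> j = u then 0 else X i j)"
proof -
  let ?Y = "\<lambda>c i j. if i = u \<and> j = u then c else X i j"
  have "setdet (nodes H - {u}) (blockm x T H (?Y 1)) = blockdet x T H (?Y 1) - blockdet x T H (?Y 0)"
    unfolding blockdet_def by (rule setdet_remove) (use assms in \<open>auto simp: blockm_def\<close>)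
  moreover have "blockdet x (T - {u}) \<lparr>nodes = nodes H - {u}, mult = mult H\<rparr> X =
      setdet (nodes H - {u}) (blockm x T H (?Y 1))"
    unfolding blockdet_def by (rule setdet_cong) (auto simp: blockm_def charm_def)
  ultimately show ?thesis by simp
qed

text \<open>Resetting the corner at \<open>z\<close> to 1 costs the last summand, and a Schur
  complement then eliminates \<open>z\<close>. As the neighbours of \<open>z\<close> lie in
  \<open>T\<close>, the correction stays within the block.\<close>

lemma blockdet_add_node:
  assumes fin: "finite (nodes H)" and z: "z \<notin> nodes H" and T: "A \<subseteq> T" "T \<subseteq> nodes H"
  shows "blockdet x (insert z T) (add_node z A H) X =
    blockdet x T H (\<lambda>i j. X i j - X i z * X z j) + (X z z - 1) * blockdet x T H X"
proof -
  let ?N = "nodes H" and ?X1 = "\<lambda>i j. if i = z \<and> j = z then 1 else X i j"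
  let ?M = "blockm x (insert z T) (add_node z A H) X"
  let ?M1 = "blockm x (insert z T) (add_node z A H) ?X1"
  have "setdet (insert z ?N) ?M = setdet (insert z ?N) ?M1 + (?M z z - ?M1 z z) * setdet (insert z ?N - {z}) ?M"
    by (rule setdet_diff_diag) (use fin in \<open>auto simp: blockm_def\<close>)
  also have "insert z ?N - {z} = ?N" using z by auto
  also have "?M z z - ?M1 z z = X z z - 1" by (simp add: blockm_def)
  also have "setdet ?N ?M = blockdet x T H X"
    unfolding blockdet_def
    by (rule setdet_cong) (use z in \<open>auto simp: blockm_def charm_def add_node_def\<close>)
  also have "setdet (insert z ?N) ?M1 = setdet ?N (\<lambda>i j. ?M1 i j - ?M1 i z * ?M1 z j)"
    by (rule setdet_schur_unit[OF fin z]) (simp add: blockm_def)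
  also have "\<dots> = blockdet x T H (\<lambda>i j. X i j - X i z * X z j)"
    unfolding blockdet_def
    by (rule setdet_cong)
       (use z T in \<open>auto simp: blockm_def charm_def add_node_def idm_def subset_iff\<close>)
  finally show ?thesis by (simp add: blockdet_def add_node_def)
qed

text \<open>Adding row and column \<open>v\<close> to row and column \<open>u\<close> turns \<open>u\<close> into the amalgamated vertex;
  the block is chosen such that this row and column operation leads to \<open>X\<close>.\<close>

lemma blockdet_amalgamate:
  fixes H :: "'v pseudograph" and X :: "'v \<Rightarrow> 'v \<Rightarrow> complex"
  assumes fin: "finite (nodes H)" and z: "z \<notin> nodes H"
    and uv: "u \<in> T" "v \<in> T" "u \<noteq> v" and T: "T \<subseteq> nodes H"
    and H'_def: "H' = \<lparr> nodes = insert z (nodes H - {u, v}),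
       mult = (\<lambda>x y. if x = z \<and> y = z then mult H u u + mult H v v + mult H u v
                     else if x = z then mult H u y + mult H v y
                     else if y = z then mult H x u + mult H x v
                     else mult H x y) \<rparr>"
  defines "r \<equiv> \<lambda>i. if i = u then z else i"
  defines "Y \<equiv> \<lambda>c i j. (if i = v \<or> j = v then 0 else X (r i) (r j)) +
      c * (idm i u - idm i v) * (idm j u - idm j v)"
  shows "blockdet x (insert z (T - {u, v})) H' X = blockdet x T H (Y 1) - blockdet x T H (Y 0)"
proof -
  let ?N = "nodes H"
  have H': "nodes H' = insert z (nodes H - {u, v})"
    "\<And>j. j \<noteq> z \<Longrightarrow> mult H' z j = mult H u j + mult H v j"
    "\<And>i. i \<noteq> z \<Longrightarrow> mult H' i z = mult H i u + mult H i v"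
    "\<And>i j. i \<noteq> z \<Longrightarrow> j \<noteq> z \<Longrightarrow> mult H' i j = mult H i j"
    by (simp_all add: H'_def)
  have uvN: "u \<in> ?N" "v \<in> ?N" using uv T by auto
  define Q where "Q = (\<lambda>c. blockm x T H (Y c))"
  define R where "R = (\<lambda>c i j. if i = u then Q c u j + 1 * Q c v j else Q c i j)"
  define P where "P = (\<lambda>c i j. if j = u then R c i u + 1 * R c i v else R c i j)"
  have P: "setdet ?N (P c) = blockdet x T H (Y c)" for c
    unfolding P_def setdet_add_column[OF fin uvN uv(3)] unfolding R_def setdet_add_row[OF fin uvN uv(3)]
    by (simp add: blockdet_def Q_def)
  \<comment> \<open>The row and column operations turn \<open>idm i u - idm i v\<close> into
    \<open>- idm i v\<close>, so the rank-one term of \<open>Y\<close> shrinks to the single entry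
    \<open>c\<close> at \<open>(v, v)\<close>. Subtracting the cases \<open>c = 1\<close> and
    \<open>c = 0\<close> therefore deletes \<open>v\<close>.\<close>
  have PT: "P c i j = (if i = v \<or> j = v then if i = j then c else 0 else X (r i) (r j))"
    if "i \<in> T" "j \<in> T" for c i j
    using that uv by (auto simp: P_def R_def Q_def Y_def blockm_def idm_def)
  have PnT: "P c i j = P 0 i j" if "i \<notin> T \<or> j \<notin> T" for c i j
    using that uv by (auto simp: P_def R_def Q_def blockm_def)
  have "setdet (?N - {v}) (P 1) = setdet ?N (P 1) - setdet ?N (P 0)"
  proof (rule setdet_remove[OF fin uvN(2)])
    fix i j assume "i \<noteq> v \<or> j \<noteq> v"
    then show "P 1 i j = P 0 i j"
      by (cases "i \<in> T \<and> j \<in> T") (auto simp: PT PnT[of i j 1])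
  qed (use uv in \<open>auto simp: PT\<close>)
  moreover have "blockdet x (insert z (T - {u, v})) H' X = setdet (?N - {v}) (P 1)"
  proof -
    have b: "bij_betw r (?N - {v}) (insert z (?N - {u, v}))"
      using z uvN uv(3) by (auto simp: bij_betw_def inj_on_def r_def)
    have "blockdet x (insert z (T - {u, v})) H' X =
        setdet (?N - {v}) (\<lambda>i j. blockm x (insert z (T - {u, v})) H' X (r i) (r j))"
      unfolding blockdet_def H'(1) by (rule setdet_reindex[OF b]) (use fin in simp)
    also have "\<dots> = setdet (?N - {v}) (P 1)"
    proof (rule setdet_cong[OF refl])
      fix i j assume ij: "i \<in> ?N - {v}" "j \<in> ?N - {v}"
      then have zij: "i \<noteq> z" "j \<noteq> z" using z by auto
      show "blockm x (insert z (T - {u, v})) H' X (r i) (r j) = P 1 i j"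
      proof (cases "i \<in> T \<and> j \<in> T")
        case True
        then show ?thesis using ij by (auto simp: PT blockm_def r_def)
      next
        case False
        \<comment> \<open>Only entries with an index outside \<open>T\<close> are matched with
          \<open>H'\<close> here. The diagonal entry at \<open>z\<close>, where an edge
          \<open>uv\<close> becomes a loop, belongs to the block and is given by
          \<open>X\<close>.\<close>
        then show ?thesis using ij zij uv H'(2-4) z
          by (auto simp: P_def R_def Q_def blockm_def r_def charm_def idm_def)
      qed
    qed
    finally show ?thesis .
  qed
  ultimately show ?thesis by (simp add: P)
qed

text \<open>The invariant for induction along a sequence of perturbations. Equality of the two
  blocks is recorded separately because \<open>blockdet\<close> forgets them.\<close>

definition similar_outside ::
  "complex \<Rightarrow> 'a set \<Rightarrow> 'a vertex pseudograph \<Rightarrow> 'a vertex pseudograph \<Rightarrow> bool" where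
  "similar_outside x S H H' \<longleftrightarrow> finite (nodes H) \<and> nodes H' = nodes H \<and>
     (\<forall>i\<in>available S H. \<forall>j\<in>available S H. mult H' i j = mult H i j) \<and>
     (\<forall>X. blockdet x (available S H) H' X = blockdet x (available S H) H X)"

lemma similar_outside_perturb:
  assumes sim: "similar_outside x S H H'" and app: "applicable S H p"
  shows "similar_outside x S (perturb p H) (perturb p H')"
proof -
  let ?T = "available S H"
  have fin: "finite (nodes H)" "finite (nodes H')" and nodes: "nodes H' = nodes H"
    and m: "\<And>i j. i \<in> ?T \<Longrightarrow> j \<in> ?T \<Longrightarrow> mult H' i j = mult H i j"
    and b: "\<And>X. blockdet x ?T H' X = blockdet x ?T H X"
    using sim by (auto simp: similar_outside_def)
  have T: "?T \<subseteq> nodes H" by (auto simp: available_def)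
  show ?thesis
  proof (cases p)
    case (Remove u)
    have u: "u \<in> ?T" using app Remove by simp
    have T': "available S (perturb p H) = ?T - {u}" by (auto simp: available_def Remove)
    show ?thesis
      unfolding similar_outside_def T'
      using m fin nodes
        blockdet_remove[OF fin(1) u T] blockdet_remove[OF fin(2) u T[folded nodes]] b
      by (simp add: Remove)
  next
    case (Add_Loop u)
    have u: "u \<in> ?T" using app Add_Loop by simp
    have T': "available S (perturb p H) = ?T" by (auto simp: available_def Add_Loop)
    have "blockdet x ?T (perturb p K) X = blockdet x ?T K X" for K X
      by (rule blockdet_change_block) (use u in \<open>auto simp: Add_Loop\<close>)
    then have "blockdet x ?T (perturb p H') X = blockdet x ?T (perturb p H) X" for X
      by (simp only: b)
    then show ?thesis
      unfolding similar_outside_def T' using m fin nodes u by (simp add: Add_Loop)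
  next
    case (Flip u v)
    have u: "u \<in> ?T" "v \<in> ?T" using app Flip by simp_all
    have T': "available S (perturb p H) = ?T" by (auto simp: available_def Flip)
    have "blockdet x ?T (perturb p K) X = blockdet x ?T K X" for K X
      by (rule blockdet_change_block) (use u in \<open>auto simp: Flip\<close>)
    then have "blockdet x ?T (perturb p H') X = blockdet x ?T (perturb p H) X" for X
      by (simp only: b)
    then show ?thesis
      unfolding similar_outside_def T' using m fin nodes u by (simp add: Flip)
  next
    case (Add_Pendant u k)
    have u: "{u} \<subseteq> ?T" and z: "New k \<notin> nodes H" using app Add_Pendant by simp_all
    have T': "available S (perturb p H) = insert (New k) ?T"
      by (auto simp: available_def Add_Pendant add_node_def)
    have "blockdet x (insert (New k) ?T) (perturb p H') X =
        blockdet x (insert (New k) ?T) (perturb p H) X" for X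
      using blockdet_add_node[OF fin(1) z u T]
        blockdet_add_node[OF fin(2) z[folded nodes] u T[folded nodes]] b
      by (simp add: Add_Pendant)
    moreover have "mult (perturb p H') i j = mult (perturb p H) i j"
      if "i \<in> insert (New k) ?T" "j \<in> insert (New k) ?T" for i j
      using that m by (auto simp: Add_Pendant add_node_def)
    moreover have "finite (nodes (perturb p H))" "nodes (perturb p H') = nodes (perturb p H)"
      using fin nodes by (simp_all add: Add_Pendant add_node_def)
    ultimately show ?thesis unfolding similar_outside_def T' by blast
  next
    case (Add_Common_Neighbour u v k)
    have u: "{u, v} \<subseteq> ?T" and z: "New k \<notin> nodes H"
      using app Add_Common_Neighbour by simp_all
    have T': "available S (perturb p H) = insert (New k) ?T"
      by (auto simp: available_def Add_Common_Neighbour add_node_def)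
    have "blockdet x (insert (New k) ?T) (perturb p H') X =
        blockdet x (insert (New k) ?T) (perturb p H) X" for X
      using blockdet_add_node[OF fin(1) z u T]
        blockdet_add_node[OF fin(2) z[folded nodes] u T[folded nodes]] b
      by (simp add: Add_Common_Neighbour)
    moreover have "mult (perturb p H') i j = mult (perturb p H) i j"
      if "i \<in> insert (New k) ?T" "j \<in> insert (New k) ?T" for i j
      using that m by (auto simp: Add_Common_Neighbour add_node_def)
    moreover have "finite (nodes (perturb p H))" "nodes (perturb p H') = nodes (perturb p H)"
      using fin nodes by (simp_all add: Add_Common_Neighbour add_node_def)
    ultimately show ?thesis unfolding similar_outside_def T' by blast
  next
    case (Amalgamate u v k)
    have u: "u \<in> ?T" "v \<in> ?T" "u \<noteq> v" and z: "New k \<notin> nodes H"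
      using app Amalgamate by simp_all
    have T': "available S (perturb p H) = insert (New k) (?T - {u, v})"
      by (auto simp: available_def Amalgamate)
    have "blockdet x (insert (New k) (?T - {u, v})) (perturb p H') X =
        blockdet x (insert (New k) (?T - {u, v})) (perturb p H) X" for X
      unfolding Amalgamate perturb.simps
      unfolding blockdet_amalgamate[OF fin(1) z u T refl]
        blockdet_amalgamate[OF fin(2) z[folded nodes] u T[folded nodes] refl] b ..
    moreover have "mult (perturb p H') i j = mult (perturb p H) i j"
      if "i \<in> insert (New k) (?T - {u, v})" "j \<in> insert (New k) (?T - {u, v})" for i j
      using that m u by (auto simp: Amalgamate)
    ultimately show ?thesis
      unfolding similar_outside_def T' using fin nodes by (simp add: Amalgamate)
  qed
qed

lemma similar_outside_perturbs:
  "similar_outside x S H H' \<Longrightarrow> applicables S H ps \<Longrightarrow>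
    similar_outside x S (perturbs ps H) (perturbs ps H')"
  by (induction ps arbitrary: H H') (simp_all add: similar_outside_perturb)

text \<open>Choosing for \<open>X\<close> the actual block, common to both pseudographs, undoes the
  replacement.\<close>

lemma similar_outside_det:
  assumes "similar_outside x S H H'"
  shows "setdet (nodes H) (charm x H) = setdet (nodes H') (charm x H')"
proof -
  let ?T = "available S H"
  have "setdet (nodes H) (charm x H) = blockdet x ?T H (charm x H)"
    unfolding blockdet_def by (rule setdet_cong) (auto simp: blockm_def)
  also have "\<dots> = blockdet x ?T H' (charm x H)" using assms by (simp add: similar_outside_def)
  also have "\<dots> = setdet (nodes H') (charm x H')"
    unfolding blockdet_def
    by (rule setdet_cong) (use assms in \<open>auto simp: blockm_def charm_def similar_outside_def\<close>)
  finally show ?thesis .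
qed

lemma finite_nodes_perturbs: "finite (nodes H) \<Longrightarrow> finite (nodes (perturbs ps H))"
proof (induction ps arbitrary: H)
  case (Cons p ps)
  have "finite (nodes (perturb p H))" using Cons.prems by (cases p) (simp_all add: add_node_def)
  then show ?case using Cons.IH by simp
qed simp

section \<open>From distance-regularity to perturbations\<close>

text \<open>The complements of \<open>S\<close> and of its image in \<open>A\<close> have equal size
  and are matched arbitrarily. No preservation of distances is asked of the extension outside
  \<open>S\<close>.\<close>

lemma extend_inj_to_permutation:
  assumes fin: "finite A" and S: "S \<subseteq> A" and f: "inj_on f S" "f ` S \<subseteq> A"
  obtains \<pi> where "\<pi> permutes A" "\<And>u. u \<in> S \<Longrightarrow> \<pi> u = f u"
proof -
  have finS: "finite S" using fin S finite_subset by blast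
  have "card (A - S) = card (A - f ` S)"
    using S f fin finS by (simp add: card_Diff_subset card_image)
  then obtain h where h: "bij_betw h (A - S) (A - f ` S)"
    using fin finite_same_card_bij by blast
  define \<pi> where "\<pi> u = (if u \<in> S then f u else if u \<in> A then h u else u)" for u
  have "bij_betw \<pi> S (f ` S)"
    using f(1) by (simp add: bij_betw_def \<pi>_def inj_on_def)
  moreover have "bij_betw \<pi> (A - S) (A - f ` S)"
    using h by (rule bij_betw_cong[THEN iffD1, rotated]) (simp add: \<pi>_def)
  ultimately have "bij_betw \<pi> (S \<union> (A - S)) (f ` S \<union> (A - f ` S))"
    by (rule bij_betw_combine) auto
  then have "bij_betw \<pi> A A" using S f(2) by (simp add: Un_absorb1)
  then have "\<pi> permutes A" by (rule bij_imp_permutes) (use S in \<open>auto simp: \<pi>_def\<close>)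
  then show thesis by (rule that) (simp add: \<pi>_def)
qed

context connected_pair_graph begin

text \<open>Under distance-regularity, \<open>\<kappa>\<close> solves the system given by the intersection matrix
  \<open>L\<^sub>k\<^sub>j = p\<^sup>k\<^sub>1\<^sub>j\<close>, of which only the entries for distances occurring in \<open>G\<close> matter.\<close>

lemma distance_regular_resolvent:
  assumes "distance_regular G"
  obtains F where "finite F"
    "\<And>x. x \<notin> F \<Longrightarrow> \<exists>\<kappa>. \<forall>u\<in>V. \<forall>v\<in>V. mmul V (charadj x) (\<lambda>u v. \<kappa> (d u v)) u v = idm u v"
proof -
  obtain p where "\<forall>i j k. \<forall>u\<in>V. \<forall>v\<in>V. d u v = k \<longrightarrow>
      card {w \<in> V. d u w = i \<and> d v w = j} = p i j k"
    using assms unfolding distance_regular_def by (elim exE)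
  then have p: "card {w \<in> V. d u w = i \<and> d v w = j} = p i j (d u v)"
    if "u \<in> V" "v \<in> V" for i j u v
    using that by blast
  have "finite ((\<lambda>(u, v). d u v) ` (V \<times> V))" by simp
  then obtain n where n: "\<And>u v. u \<in> V \<Longrightarrow> v \<in> V \<Longrightarrow> d u v < n"
    unfolding finite_nat_set_iff_bounded by fastforce
  let ?L = "\<lambda>k j. of_nat (p 1 j k) :: complex"
  let ?F = "{x. setdet {..<n} (\<lambda>k j. x * idm k j - ?L k j) = 0}"
  show thesis
  proof (rule that[of ?F])
    show "finite ?F" by (rule finite_setdet_char_zero) simp
  next
    fix x assume "x \<notin> ?F"
    then have nz: "setdet {..<n} (\<lambda>k j. x * idm k j - ?L k j) \<noteq> 0" by simp
    obtain K where K: "\<And>i j. i < n \<Longrightarrow> j < n \<Longrightarrow>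
        mmul {..<n} (\<lambda>k j. x * idm k j - ?L k j) K i j = idm i j"
      by (rule setdet_nonzero_inverse[OF finite_lessThan nz]) (rule that, simp)
    \<comment> \<open>Column 0 of the inverse, because the right-hand side \<open>idm u v\<close> is
      1 at distance 0 and 0 at every other distance.\<close>
    let ?\<kappa> = "\<lambda>k. K k 0"
    have "mmul V (charadj x) (\<lambda>u v. ?\<kappa> (d u v)) u v = idm u v" if uv: "u \<in> V" "v \<in> V" for u v
    proof -
      let ?k = "d u v"
      have k: "?k < n" "0 < n" using n[OF uv] by auto
      have "(\<Sum>w\<in>V. adj u w * ?\<kappa> (d w v)) = (\<Sum>w\<in>{w \<in> V. d u w = 1}. ?\<kappa> (d v w))"
        unfolding sum.inter_filter[OF finite_V]
        by (intro sum.cong) (auto simp: adj_gdist uv gdist_sym[of _ v])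
      \<comment> \<open>Grouping the neighbours of \<open>u\<close> by their distance from
        \<open>v\<close> brings in the intersection numbers.\<close>
      also have "\<dots> = (\<Sum>j<n. \<Sum>w\<in>{w \<in> {w \<in> V. d u w = 1}. d v w = j}. ?\<kappa> (d v w))"
        by (rule sum.group[symmetric]) (use n uv in auto)
      also have "\<dots> = (\<Sum>j<n. ?L ?k j * ?\<kappa> j)"
        by (intro sum.cong refl) (simp add: p[OF uv, symmetric] conj_assoc)
      finally have "mmul V (charadj x) (\<lambda>u v. ?\<kappa> (d u v)) u v =
          x * ?\<kappa> ?k - (\<Sum>j<n. ?L ?k j * ?\<kappa> j)"
        using mmul_idm[OF finite_V uv(1), of "\<lambda>u v. x * ?\<kappa> (d u v)" v]
        by (simp add: mmul_def algebra_simps sum_subtractf)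
      also have "\<dots> = mmul {..<n} (\<lambda>k j. x * idm k j - ?L k j) K ?k 0"
        using mmul_idm[of "{..<n}" ?k "\<lambda>k j. x * K k j" 0] k
        by (simp add: mmul_def algebra_simps sum_subtractf)
      also have "\<dots> = idm u v"
        using K[OF k] gdist_eq_0_iff[OF uv] by (simp add: idm_def)
      finally show ?thesis .
    qed
    then show "\<exists>\<kappa>. \<forall>u\<in>V. \<forall>v\<in>V. mmul V (charadj x) (\<lambda>u v. \<kappa> (d u v)) u v = idm u v"
      by (intro exI[of _ ?\<kappa>]) simp
  qed
qed

text \<open>An isomorphic copy of \<open>G\<close> on the same nodes, in which \<open>S\<close>
  occupies the position that its image under \<open>\<pi>\<close> has in \<open>G\<close>. One
  sequence of perturbations at \<open>S\<close> can thus be run on both graphs.\<close>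

definition pullback :: "('a \<Rightarrow> 'a) \<Rightarrow> 'a vertex pseudograph" where
  "pullback \<pi> = \<lparr> nodes = Orig ` V,
     mult = (\<lambda>x y. mult (pseudograph_of G) (map_vertex \<pi> x) (map_vertex \<pi> y)) \<rparr>"

lemma relabel_pullback:
  assumes "\<pi> permutes V"
  shows "relabel \<pi> (pullback \<pi>) = pseudograph_of G"
proof -
  have "map_vertex \<pi> ` Orig ` V = Orig ` \<pi> ` V" by (simp add: image_image)
  then have "nodes (relabel \<pi> (pullback \<pi>)) = nodes (pseudograph_of G)"
    using permutes_image[OF assms] by (simp add: relabel_def pullback_def)
  moreover have "mult (relabel \<pi> (pullback \<pi>)) = mult (pseudograph_of G)"
    by (intro ext) (simp add: relabel_def pullback_def map_vertex_inv[OF permutes_bij[OF assms]])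
  ultimately show ?thesis by simp
qed

text \<open>The matrices \<open>?B\<close> and \<open>?B'\<close> differ by a simultaneous
  permutation, so their determinants agree. Their inverses are \<open>\<kappa>\<close> of the
  distances before and after applying \<open>\<pi>\<close>, which coincide on
  \<open>S\<close>.\<close>

lemma similar_outside_pullback:
  assumes \<pi>: "\<pi> permutes V" and S: "S \<subseteq> V"
    and dist: "\<And>u v. u \<in> S \<Longrightarrow> v \<in> S \<Longrightarrow> d (\<pi> u) (\<pi> v) = d u v"
    and \<kappa>: "\<And>u v. u \<in> V \<Longrightarrow> v \<in> V \<Longrightarrow> mmul V (charadj x) (\<lambda>u v. \<kappa> (d u v)) u v = idm u v"
  shows "similar_outside x S (pseudograph_of G) (pullback \<pi>)"
proof -
  let ?B = "charadj x" and ?B' = "\<lambda>u v. charadj x (\<pi> u) (\<pi> v)"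
  have av: "available S (pseudograph_of G) = Orig ` S"
    using S by (auto simp: available_def)
  have \<pi>V: "u \<in> V \<Longrightarrow> \<pi> u \<in> V" for u using permutes_in_image[OF \<pi>] by simp
  have \<pi>_idm: "idm (\<pi> u) (\<pi> v) = idm u v" for u v
    using permutes_inj[OF \<pi>] by (simp add: idm_def inj_eq)
  have adj_S: "adj (\<pi> u) (\<pi> v) = adj u v" if "u \<in> S" "v \<in> S" for u v
    using that S dist[OF that] \<pi>V by (simp add: adj_gdist subset_iff)
  have mult_eq: "mult (pullback \<pi>) (Orig u) (Orig v) = (if (\<pi> u, \<pi> v) \<in> parcs G then 1 else 0)" for u v
    by (simp add: pullback_def pseudograph_of_def)
  have charm_eq: "charm x (pullback \<pi>) (Orig u) (Orig v) = ?B' u v" for u v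
    by (simp add: charm_def mult_eq adj_def \<pi>_idm) (simp add: idm_def)
  have det: "setdet V ?B = setdet V ?B'"
    by (rule setdet_reindex) (use permutes_imp_bij[OF \<pi>] in auto)
  have inv': "mmul V ?B' (\<lambda>u v. \<kappa> (d (\<pi> u) (\<pi> v))) u v = idm u v" if "u \<in> V" "v \<in> V" for u v
    using \<kappa>[OF \<pi>V[OF that(1)] \<pi>V[OF that(2)]]
      sum.permute[OF \<pi>, of "\<lambda>w. charadj x (\<pi> u) w * \<kappa> (d w (\<pi> v))"]
    by (simp only: mmul_def o_def \<pi>_idm)
  have "blockdet x (Orig ` S) (pullback \<pi>) X = blockdet x (Orig ` S) (pseudograph_of G) X" for X
  proof -
    \<comment> \<open>The matrices \<open>?B\<close> and \<open>?B'\<close> have the same block on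
      \<open>S\<close>, so adding the same \<open>Z\<close> replaces that block by \<open>X\<close>
      in both.\<close>
    define Z where "Z u v = (if u \<in> S \<and> v \<in> S then X (Orig u) (Orig v) - ?B u v else 0)" for u v
    have "blockdet x (Orig ` S) (pseudograph_of G) X = setdet V (\<lambda>u v. ?B u v + Z u v)"
      unfolding blockdet_def nodes_pseudograph_of setdet_Orig[OF finite_V]
      by (rule setdet_cong) (auto simp: blockm_def Z_def)
    also have "\<dots> = setdet V (\<lambda>u v. ?B' u v + Z u v)"
      by (rule setdet_add_block_cong[OF finite_V \<kappa> inv' det, where S = S])
         (auto simp: dist Z_def)
    also have "\<dots> = setdet (Orig ` V) (blockm x (Orig ` S) (pullback \<pi>) X)"
      unfolding setdet_Orig[OF finite_V]
      by (rule setdet_cong) (auto simp: blockm_def Z_def charm_eq adj_S \<pi>_idm)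
    also have "\<dots> = blockdet x (Orig ` S) (pullback \<pi>) X"
      by (simp add: blockdet_def pullback_def)
    finally show ?thesis by simp
  qed
  moreover have "mult (pullback \<pi>) (Orig u) (Orig v) = mult (pseudograph_of G) (Orig u) (Orig v)"
    if "u \<in> S" "v \<in> S" for u v
    using adj_S[OF that] by (auto simp: mult_eq adj_def pseudograph_of_def split: if_splits)
  ultimately show ?thesis
    unfolding similar_outside_def av by (auto simp: pullback_def)
qed

lemma distance_regular_perturb_cospectral:
  assumes dr: "distance_regular G" and U: "U \<subseteq> V" "U' \<subseteq> V" and iso: "isometric G U U'"
  shows "perturb_cospectral G U U'"
proof -
  obtain f where f: "bij_betw f U U'" and df: "\<And>u v. u \<in> U \<Longrightarrow> v \<in> U \<Longrightarrow> d u v = d (f u) (f v)"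
    using iso unfolding isometric_def by blast
  obtain F where F: "finite F" and \<kappa>:
    "\<And>x. x \<notin> F \<Longrightarrow> \<exists>\<kappa>. \<forall>u\<in>V. \<forall>v\<in>V. mmul V (charadj x) (\<lambda>u v. \<kappa> (d u v)) u v = idm u v"
    by (rule distance_regular_resolvent[OF dr]) (rule that, assumption, blast)
  have "cospectral (perturbs ps (pseudograph_of G))
      (perturbs (map (map_perturbation f) ps) (pseudograph_of G))"
    if S: "S \<subseteq> U" and app: "applicables S (pseudograph_of G) ps" for S ps
  proof -
    have fS: "inj_on f S" "f ` S \<subseteq> V" "S \<subseteq> V"
      using f S U by (auto simp: bij_betw_def intro: inj_on_subset)
    obtain \<pi> where \<pi>: "\<pi> permutes V" "\<And>u. u \<in> S \<Longrightarrow> \<pi> u = f u"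
      by (rule extend_inj_to_permutation[OF finite_V fS(3,1,2)]) (rule that, assumption, blast)
    note bij = permutes_bij[OF \<pi>(1)]
    let ?H = "perturbs ps (pseudograph_of G)" and ?H' = "perturbs ps (pullback \<pi>)"
    have map_eq: "map (map_perturbation f) ps = map (map_perturbation \<pi>) ps"
      using app by (rule map_perturbation_applicables) (simp add: \<pi>(2))
    \<comment> \<open>The sequence at the image of \<open>S\<close> in \<open>G\<close> is the given
      sequence run on \<open>pullback \<pi>\<close>, up to renaming.\<close>
    have rel: "perturbs (map (map_perturbation f) ps) (pseudograph_of G) = relabel \<pi> ?H'"
      unfolding map_eq
      using perturbs_relabel[OF bij, of ps "pullback \<pi>"] unfolding relabel_pullback[OF \<pi>(1)] .
    have fin: "finite (nodes ?H)" "finite (nodes ?H')"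
      by (simp_all add: finite_nodes_perturbs pullback_def)
    have "setdet (nodes ?H) (charm x ?H) = setdet (nodes (relabel \<pi> ?H')) (charm x (relabel \<pi> ?H'))"
      if x: "x \<notin> F" for x
    proof -
      obtain k where k: "\<And>u v. u \<in> V \<Longrightarrow> v \<in> V \<Longrightarrow> mmul V (charadj x) (\<lambda>u v. k (d u v)) u v = idm u v"
        using \<kappa>[OF x] by blast
      have "similar_outside x S (pseudograph_of G) (pullback \<pi>)"
      proof (rule similar_outside_pullback[OF \<pi>(1) fS(3) _ k])
        fix u v assume "u \<in> S" "v \<in> S"
        moreover from this have "u \<in> U" "v \<in> U" using S by auto
        ultimately show "d (\<pi> u) (\<pi> v) = d u v" using df[of u v] by (simp add: \<pi>(2))
      qed
      from similar_outside_det[OF similar_outside_perturbs[OF this app]] show ?thesis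
        unfolding setdet_relabel[OF bij fin(2)] .
    qed
    moreover have "finite (nodes (relabel \<pi> ?H'))" using fin(2) by (simp add: relabel_def)
    ultimately show ?thesis unfolding rel using fin(1) F by (intro cospectralI)
  qed
  then show ?thesis unfolding perturb_cospectral_def using f by blast
qed

end

theorem theorem5p3:
  fixes G :: "'a pair_pre_digraph"
  assumes "pair_graph G" and "connected (with_proj G)"
  shows "distance_regular G \<longleftrightarrow>
    (\<forall>U U'. U \<subseteq> pverts G \<longrightarrow> U' \<subseteq> pverts G \<longrightarrow> isometric G U U' \<longrightarrow> perturb_cospectral G U U')"
proof -
  interpret pair_graph G by fact
  interpret connected_pair_graph G by unfold_locales fact
  show ?thesis
  proof (intro iffI allI impI)
    fix U U' assume "distance_regular G" "U \<subseteq> V" "U' \<subseteq> V" "isometric G U U'"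
    then show "perturb_cospectral G U U'" by (rule distance_regular_perturb_cospectral)
  next
    assume cosp: "\<forall>U U'. U \<subseteq> V \<longrightarrow> U' \<subseteq> V \<longrightarrow> isometric G U U' \<longrightarrow> perturb_cospectral G U U'"
    have "distinv K" if "resolvent x K" for x K
      by (rule resolvent_distinv[OF _ that]) (use cosp in blast)
    then have "distinv (apow l)" for l using apow_distinv by blast
    then show "distance_regular G" by (rule distance_regular_if_distinv)
  qed
qed

end
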